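(* Let $\Gamma$ be an acyclic perfect planar network with $m$ sources and $n$ sinks separated from each other on the boundary of the disk, and let $B=B_\Gamma$ be its $m\times n$ boundary measurement matrix. Then, for the standard double bracket on the path category $\mathcal C$ of $\Gamma$, $$\{\!\{B,B\}\!\} \;=\; r_m\,(B_L\boxtimes B_R)\;-\;\Big((B_L\boxtimes B_R)\,r_n\Big)^{\tau}.$$ In particular, if $B$ is square ($m=n$), then $\{\!\{B,B\}\!\}=[r_n,\;B_L\boxtimes B_R]_\tau$, where $[P,Q]_\tau:=PQ-(QP)^\tau$ is the twisted commutator.
   Context: Networks. A perfect planar network is a finite directed graph $\Gamma$ embedded in a closed disk such that boundary vertices are univalent and internal vertices are trivalent and are neither sources nor sinks. An internal vertex is white if it has exactly one incoming edge and black if it has exactly one outgoing edge. Boundary vertices are sources or sinks. "Separated" means that the sources occur consecutively along the boundary circle and so do the sinks; the disk is then drawn with sources on the left and sinks on the right, and sources are labelled $1,\dots,m$ and sinks $1,\dots,n$ from top to bottom. Path category. Let $\mathbf k$ be a ground field containing $\mathbb Q$. $\mathcal C$ is the $\mathbf k$-linear category whose objects are the vertices of $\Gamma$ and whose morphisms are $\mathbf k$-linear combinations of directed paths. Composition is concatenation, written left to right ($fg$ = first $f$, then $g$). $s(f),t(f)$ denote source and target. Tensor products $\otimes=\otimes_{\mathbf k}$ of morphisms are multiplied componentwise, $(f\otimes g)(h\otimes k)=fh\otimes gk$, and $(f\otimes g)^\tau=g\otimes f$. The boundary measurement matrix $B_\Gamma$ has entries $b_{ij}=\sum_{p:i\to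 j}\mathrm{wt}(p)$, the sum over directed paths from source $i$ to sink $j$, where $\mathrm{wt}(p)\in\mathcal C$ is the path $p$ viewed as a word in the edges. Standard double bracket. $\{\!\{-,-\}\!\}$ is the collection of $\mathbf k$-linear maps $\mathrm{Hom}(A,A')\otimes\mathrm{Hom}(D,D')\to\mathrm{Hom}(D,A')\otimes\mathrm{Hom}(A,D')$ determined by: (i) skew-symmetry $\{\!\{f,g\}\!\}=-\{\!\{g,f\}\!\}^\tau$; (ii) Leibniz rules $\{\!\{fg,h\}\!\}=(\mathbf 1_{s(h)}\otimes f)\{\!\{g,h\}\!\}+\{\!\{f,h\}\!\}(g\otimes\mathbf 1_{t(h)})$ and $\{\!\{f,gh\}\!\}=(g\otimes\mathbf 1_{s(f)})\{\!\{f,h\}\!\}+\{\!\{f,g\}\!\}(\mathbf 1_{t(f)}\otimes h)$; (iii) values on pairs of edges, obtained by summing contributions of all internal vertices: at a white vertex with incoming edge $x_3$ and outgoing edges $x_1,x_2$, where $x_1,x_2,x_3$ are in counterclockwise cyclic order, the contribution is $\{\!\{x_1,x_2\}\!\}=\frac12\,x_1\otimes x_2$; at a black vertex with outgoing edge $y_3$ and incoming edges $y_1,y_2$, where $y_1,y_2,y_3$ are in counterclockwise cyclic order, the contribution is $\{\!\{y_1,y_2\}\!\}=-\frac12\,y_2\otimes y_1$; all other contributions, except those following from these by skew-symmetry, are zero. Matrix notation. $E_{ij}$ are matrix units and $\boxtimes$ is the tensor product of matrices. For matrices $X,Y$ over $\mathcal C$, $\{\!\{X,Y\}\!\}=\sum_{i,j,k,l}\{\!\{x_{ij},y_{kl}\}\!\}\,E_{ij}\boxtimes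 E_{kl}$. $B_L$ has entries $b_{ij}\otimes 1$ and $B_R$ has entries $1\otimes b_{ij}$, so $B_L\boxtimes B_R=\sum (b_{ij}\otimes b_{kl})\,E_{ij}\boxtimes E_{kl}$. Multiplication by scalar matrices uses $(E_{ij}\boxtimes E_{kl})(E_{pq}\boxtimes E_{st})=E_{ij}E_{pq}\boxtimes E_{kl}E_{st}$. The operation $\tau$ is applied to the coefficients in $\mathcal C\otimes\mathcal C$ only (the matrix units are not permuted). Finally $$r_n=\frac12\sum_{1\le i<j\le n}\big(E_{ji}\boxtimes E_{ij}-E_{ij}\boxtimes E_{ji}\big).$$ *)

theory Defs
  imports
    "HOL-Analysis.Analysis"
    "HOL-Library.Poly_Mapping"
    "Graph_Theory.Graph_Theory"
begin

section \<open>Perfect planar networks\<close>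

text \<open>
  The disk is the closed unit disk of the complex plane. The vertex \<open>v\<close> is drawn at the point
  \<open>pos v\<close>, and the edge \<open>e\<close> along the continuous curve \<open>crv e\<close>, directed from tail to head. Edges
  may be loops or parallel; \<^const>\<open>simple_path\<close> allows the curve of a loop to close up.
\<close>

definition embedded_in_disk ::
    "('v, 'e) pre_digraph \<Rightarrow> ('v \<Rightarrow> complex) \<Rightarrow> ('e \<Rightarrow> real \<Rightarrow> complex) \<Rightarrow> bool" where
  "embedded_in_disk G pos crv \<longleftrightarrow>
     inj_on pos (verts G) \<and> pos ` verts G \<subseteq> cball 0 1 \<and>
     (\<forall>e\<in>arcs G. simple_path (crv e) \<and> path_image (crv e) \<subseteq> cball 0 1 \<and>
        pathstart (crv e) = pos (tail G e) \<and> pathfinish (crv e) = pos (head G e) \<and>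
        crv e ` {0<..<1} \<inter> pos ` verts G = {}) \<and>
     disjoint_family_on (\<lambda>e. crv e ` {0<..<1}) (arcs G)"

definition boundary_verts :: "('v, 'e) pre_digraph \<Rightarrow> ('v \<Rightarrow> complex) \<Rightarrow> 'v set" where
  "boundary_verts G pos = {v \<in> verts G. pos v \<in> sphere 0 1}"

definition internal_verts :: "('v, 'e) pre_digraph \<Rightarrow> ('v \<Rightarrow> complex) \<Rightarrow> 'v set" where
  "internal_verts G pos = verts G - boundary_verts G pos"

definition boundary_sources :: "('v, 'e) pre_digraph \<Rightarrow> ('v \<Rightarrow> complex) \<Rightarrow> 'v set" where
  "boundary_sources G pos = {v \<in> boundary_verts G pos. in_degree G v = 0}"

definition boundary_sinks :: "('v, 'e) pre_digraph \<Rightarrow> ('v \<Rightarrow> complex) \<Rightarrow> 'v set" where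
  "boundary_sinks G pos = {v \<in> boundary_verts G pos. out_degree G v = 0}"

locale perfect_planar_network = fin_digraph G
  for G :: "('v, 'e) pre_digraph" +
  fixes pos :: "'v \<Rightarrow> complex" and crv :: "'e \<Rightarrow> real \<Rightarrow> complex"
  assumes embedded: "embedded_in_disk G pos crv"
    and boundary_univalent:
      "v \<in> boundary_verts G pos \<Longrightarrow> in_degree G v + out_degree G v = 1"
    and internal_trivalent:
      "v \<in> internal_verts G pos \<Longrightarrow> in_degree G v + out_degree G v = 3"
    and internal_not_source: "v \<in> internal_verts G pos \<Longrightarrow> in_degree G v \<noteq> 0"
    and internal_not_sink: "v \<in> internal_verts G pos \<Longrightarrow> out_degree G v \<noteq> 0"

definition white :: "('v, 'e) pre_digraph \<Rightarrow> ('v \<Rightarrow> complex) \<Rightarrow> 'v \<Rightarrow> bool" where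
  "white G pos v \<longleftrightarrow> v \<in> internal_verts G pos \<and> in_degree G v = 1"

definition black :: "('v, 'e) pre_digraph \<Rightarrow> ('v \<Rightarrow> complex) \<Rightarrow> 'v \<Rightarrow> bool" where
  "black G pos v \<longleftrightarrow> v \<in> internal_verts G pos \<and> out_degree G v = 1"

definition acyclic_network :: "('v, 'e) pre_digraph \<Rightarrow> bool" where
  "acyclic_network G \<longleftrightarrow> (\<nexists>p. pre_digraph.cycle G p)"

text \<open>
  Sources on the left and sinks on the right, both numbered from top to bottom: going once around
  the circle counterclockwise, starting at the top, one meets the sources \<open>1, \<dots>, m\<close> and then the
  sinks \<open>n, \<dots>, 1\<close>. The condition is invariant under rotations of the disk.
\<close>

definition separated_labelling ::
    "('v, 'e) pre_digraph \<Rightarrow> ('v \<Rightarrow> complex) \<Rightarrow> nat \<Rightarrow> nat \<Rightarrow> (nat \<Rightarrow> 'v) \<Rightarrow> (nat \<Rightarrow> 'v) \<Rightarrow> bool" where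
  "separated_labelling G pos m n src snk \<longleftrightarrow>
     bij_betw src {1..m} (boundary_sources G pos) \<and>
     bij_betw snk {1..n} (boundary_sinks G pos) \<and>
     (\<exists>\<theta> :: nat \<Rightarrow> real. strict_mono_on {1..m+n} \<theta> \<and> \<theta> (m + n) < \<theta> 1 + 2 * pi \<and>
        (\<forall>i\<in>{1..m}. pos (src i) = cis (\<theta> i)) \<and>
        (\<forall>j\<in>{1..n}. pos (snk j) = cis (\<theta> (m + n + 1 - j))))"


subsection \<open>Cyclic order of edges at a vertex\<close>

text \<open>
  For a curve \<open>g\<close> starting at a point, \<open>first_hit g \<epsilon>\<close> is the first point of \<open>g\<close> at distance \<open>\<epsilon>\<close>
  from the start. Three distinct points of a circle are in counterclockwise cyclic order iff the
  triangle that they span is positively oriented. Three curves that leave a common point and are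
  otherwise disjoint are in counterclockwise cyclic order there iff their first hits with all
  sufficiently small circles around the point are; no tangent directions need to exist.
\<close>

definition first_hit :: "(real \<Rightarrow> complex) \<Rightarrow> real \<Rightarrow> complex" where
  "first_hit g \<epsilon> = g (Inf {t \<in> {0..1}. dist (g 0) (g t) = \<epsilon>})"

definition ccw_points :: "complex \<Rightarrow> complex \<Rightarrow> complex \<Rightarrow> bool" where
  "ccw_points a b c \<longleftrightarrow> Im (cnj (b - a) * (c - a)) > 0"

definition ccw_curves ::
    "(real \<Rightarrow> complex) \<Rightarrow> (real \<Rightarrow> complex) \<Rightarrow> (real \<Rightarrow> complex) \<Rightarrow> bool" where
  "ccw_curves g1 g2 g3 \<longleftrightarrow>
     (\<forall>\<^sub>F \<epsilon> in at_right 0. ccw_points (first_hit g1 \<epsilon>) (first_hit g2 \<epsilon>) (first_hit g3 \<epsilon>))"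


section \<open>The path category\<close>

text \<open>
  A path is a pair of its start vertex and its list of edges, so that \<open>(v, [])\<close> is the identity of
  \<open>v\<close>. A morphism is a finitely supported function from paths to the field. Since paths form a
  basis of the Hom spaces, tensors of two morphisms are finitely supported functions on pairs of
  paths.
\<close>

type_synonym ('v, 'e) npath = "'v \<times> 'e list"
type_synonym ('v, 'e, 'k) mor = "('v, 'e) npath \<Rightarrow>\<^sub>0 'k"
type_synonym ('v, 'e, 'k) tens = "('v, 'e) npath \<times> ('v, 'e) npath \<Rightarrow>\<^sub>0 'k"

definition paths :: "('v, 'e) pre_digraph \<Rightarrow> 'v \<Rightarrow> 'v \<Rightarrow> ('v, 'e) npath set" where
  "paths G A A' = {(A, es) | es. pre_digraph.awalk G A es A'}"

definition Hom :: "('v, 'e) pre_digraph \<Rightarrow> 'v \<Rightarrow> 'v \<Rightarrow> ('v, 'e, 'k::field_char_0) mor set" where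
  "Hom G A A' = {f. Poly_Mapping.keys f \<subseteq> paths G A A'}"

definition HomTens ::
    "('v, 'e) pre_digraph \<Rightarrow> 'v \<Rightarrow> 'v \<Rightarrow> 'v \<Rightarrow> 'v \<Rightarrow> ('v, 'e, 'k::field_char_0) tens set" where
  "HomTens G A A' D D' = {t. Poly_Mapping.keys t \<subseteq> paths G A A' \<times> paths G D D'}"

definition smul :: "'k::field_char_0 \<Rightarrow> ('b \<Rightarrow>\<^sub>0 'k) \<Rightarrow> ('b \<Rightarrow>\<^sub>0 'k)" where
  "smul c f = Poly_Mapping.map ((*) c) f"

definition bilinear_ext ::
    "('a \<Rightarrow> 'b \<Rightarrow> ('c \<Rightarrow>\<^sub>0 'k)) \<Rightarrow> ('a \<Rightarrow>\<^sub>0 'k) \<Rightarrow> ('b \<Rightarrow>\<^sub>0 'k) \<Rightarrow> ('c \<Rightarrow>\<^sub>0 'k::field_char_0)" where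
  "bilinear_ext b f g =
     (\<Sum>p\<in>Poly_Mapping.keys f. \<Sum>q\<in>Poly_Mapping.keys g.
        smul (Poly_Mapping.lookup f p * Poly_Mapping.lookup g q) (b p q))"

definition edge :: "('v, 'e) pre_digraph \<Rightarrow> 'e \<Rightarrow> ('v, 'e, 'k::field_char_0) mor" where
  "edge G e = Poly_Mapping.single (tail G e, [e]) 1"

definition ident :: "'v \<Rightarrow> ('v, 'e, 'k::field_char_0) mor" where
  "ident v = Poly_Mapping.single (v, []) 1"

text \<open>Products of paths that do not compose are set to zero.\<close>

definition path_comp ::
    "('v, 'e) pre_digraph \<Rightarrow> ('v, 'e) npath \<Rightarrow> ('v, 'e) npath \<Rightarrow> ('v, 'e, 'k::field_char_0) mor" where
  "path_comp G p q =
     (if pre_digraph.cas G (fst p) (snd p) (fst q)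
      then Poly_Mapping.single (fst p, snd p @ snd q) 1 else 0)"

definition mor_comp ::
    "('v, 'e) pre_digraph \<Rightarrow> ('v, 'e, 'k) mor \<Rightarrow> ('v, 'e, 'k) mor \<Rightarrow> ('v, 'e, 'k::field_char_0) mor" where
  "mor_comp G = bilinear_ext (path_comp G)"

definition tensor ::
    "('v, 'e, 'k) mor \<Rightarrow> ('v, 'e, 'k) mor \<Rightarrow> ('v, 'e, 'k::field_char_0) tens" where
  "tensor = bilinear_ext (\<lambda>p q. Poly_Mapping.single (p, q) 1)"

definition tens_comp ::
    "('v, 'e) pre_digraph \<Rightarrow> ('v, 'e, 'k) tens \<Rightarrow> ('v, 'e, 'k) tens \<Rightarrow> ('v, 'e, 'k::field_char_0) tens" where
  "tens_comp G =
     bilinear_ext (\<lambda>(p, p') (q, q'). tensor (path_comp G p q) (path_comp G p' q'))"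

definition tau :: "('v, 'e, 'k) tens \<Rightarrow> ('v, 'e, 'k::field_char_0) tens" where
  "tau t = Poly_Mapping.map_key prod.swap t"


section \<open>The standard double bracket\<close>

definition white_contrib ::
    "('v, 'e) pre_digraph \<Rightarrow> ('v \<Rightarrow> complex) \<Rightarrow> ('e \<Rightarrow> real \<Rightarrow> complex) \<Rightarrow> 'v \<Rightarrow> 'e \<Rightarrow> 'e \<Rightarrow>
     ('v, 'e, 'k::field_char_0) tens" where
  "white_contrib G pos crv v x1 x2 =
     (if white G pos v \<and> x1 \<in> out_arcs G v \<and> x2 \<in> out_arcs G v \<and> x1 \<noteq> x2 \<and>
         (\<exists>x3\<in>in_arcs G v. ccw_curves (crv x1) (crv x2) (reversepath (crv x3)))
      then smul (1 / 2) (tensor (edge G x1) (edge G x2)) else 0)"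

definition black_contrib ::
    "('v, 'e) pre_digraph \<Rightarrow> ('v \<Rightarrow> complex) \<Rightarrow> ('e \<Rightarrow> real \<Rightarrow> complex) \<Rightarrow> 'v \<Rightarrow> 'e \<Rightarrow> 'e \<Rightarrow>
     ('v, 'e, 'k::field_char_0) tens" where
  "black_contrib G pos crv v y1 y2 =
     (if black G pos v \<and> y1 \<in> in_arcs G v \<and> y2 \<in> in_arcs G v \<and> y1 \<noteq> y2 \<and>
         (\<exists>y3\<in>out_arcs G v. ccw_curves (reversepath (crv y1)) (reversepath (crv y2)) (crv y3))
      then smul (- (1 / 2)) (tensor (edge G y2) (edge G y1)) else 0)"

definition vertex_contrib ::
    "('v, 'e) pre_digraph \<Rightarrow> ('v \<Rightarrow> complex) \<Rightarrow> ('e \<Rightarrow> real \<Rightarrow> complex) \<Rightarrow> 'v \<Rightarrow> 'e \<Rightarrow> 'e \<Rightarrow>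
     ('v, 'e, 'k::field_char_0) tens" where
  "vertex_contrib G pos crv v e f =
     white_contrib G pos crv v e f + black_contrib G pos crv v e f"

text \<open>The subtracted term adds the values that follow by skew-symmetry.\<close>

definition edge_bracket ::
    "('v, 'e) pre_digraph \<Rightarrow> ('v \<Rightarrow> complex) \<Rightarrow> ('e \<Rightarrow> real \<Rightarrow> complex) \<Rightarrow> 'e \<Rightarrow> 'e \<Rightarrow>
     ('v, 'e, 'k::field_char_0) tens" where
  "edge_bracket G pos crv e f =
     (\<Sum>v\<in>internal_verts G pos.
        vertex_contrib G pos crv v e f - tau (vertex_contrib G pos crv v f e))"

text \<open>
  The maps \<open>Hom(A,A') \<otimes> Hom(D,D') \<rightarrow> Hom(D,A') \<otimes> Hom(A,D')\<close> are given as bilinear maps on pairs of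
  morphisms. One function serves for all choices of objects, because different Hom spaces have
  only the zero morphism in common. Values on arguments outside the Hom spaces are
  irrelevant; on the Hom spaces the axioms have exactly one solution.
\<close>

locale standard_double_bracket =
  fixes G :: "('v, 'e) pre_digraph" and pos :: "'v \<Rightarrow> complex" and crv :: "'e \<Rightarrow> real \<Rightarrow> complex"
    and br :: "('v, 'e, 'k::field_char_0) mor \<Rightarrow> ('v, 'e, 'k) mor \<Rightarrow> ('v, 'e, 'k) tens"
  assumes bracket_in_HomTens:
      "\<lbrakk>f \<in> Hom G A A'; g \<in> Hom G D D'\<rbrakk> \<Longrightarrow> br f g \<in> HomTens G D A' A D'"
    and add_left:
      "\<lbrakk>f \<in> Hom G A A'; f' \<in> Hom G A A'; g \<in> Hom G D D'\<rbrakk> \<Longrightarrow> br (f + f') g = br f g + br f' g"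
    and add_right:
      "\<lbrakk>f \<in> Hom G A A'; g \<in> Hom G D D'; g' \<in> Hom G D D'\<rbrakk> \<Longrightarrow> br f (g + g') = br f g + br f g'"
    and smul_left:
      "\<lbrakk>f \<in> Hom G A A'; g \<in> Hom G D D'\<rbrakk> \<Longrightarrow> br (smul c f) g = smul c (br f g)"
    and smul_right:
      "\<lbrakk>f \<in> Hom G A A'; g \<in> Hom G D D'\<rbrakk> \<Longrightarrow> br f (smul c g) = smul c (br f g)"
    and skew_symmetric:
      "\<lbrakk>f \<in> Hom G A A'; g \<in> Hom G D D'\<rbrakk> \<Longrightarrow> br f g = - tau (br g f)"
    and leibniz_left:
      "\<lbrakk>f \<in> Hom G A A'; g \<in> Hom G A' A''; h \<in> Hom G D D'\<rbrakk> \<Longrightarrow>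
         br (mor_comp G f g) h =
           tens_comp G (tensor (ident D) f) (br g h) + tens_comp G (br f h) (tensor g (ident D'))"
    and leibniz_right:
      "\<lbrakk>f \<in> Hom G A A'; g \<in> Hom G D D'; h \<in> Hom G D' D''\<rbrakk> \<Longrightarrow>
         br f (mor_comp G g h) =
           tens_comp G (tensor g (ident A)) (br f h) + tens_comp G (br f g) (tensor (ident A') h)"
    and bracket_edges:
      "\<lbrakk>e \<in> arcs G; e' \<in> arcs G\<rbrakk> \<Longrightarrow> br (edge G e) (edge G e') = edge_bracket G pos crv e e'"


section \<open>Matrices\<close>

text \<open>
  Matrices have indices starting from 1. An element of a product \<open>M \<boxtimes> M'\<close> of two matrix spaces is
  represented by its coefficients: \<open>X i j k l\<close> is the coefficient of \<open>E\<^sub>i\<^sub>j \<boxtimes> E\<^sub>k\<^sub>l\<close>. Entries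
  outside the index ranges are never used.
\<close>

type_synonym 'a matrix_fn = "nat \<Rightarrow> nat \<Rightarrow> 'a"
type_synonym 'a bimatrix = "nat \<Rightarrow> nat \<Rightarrow> nat \<Rightarrow> nat \<Rightarrow> 'a"

definition boundary_measurement ::
    "('v, 'e) pre_digraph \<Rightarrow> (nat \<Rightarrow> 'v) \<Rightarrow> (nat \<Rightarrow> 'v) \<Rightarrow> ('v, 'e, 'k::field_char_0) mor matrix_fn" where
  "boundary_measurement G src snk i j =
     (\<Sum>p\<in>paths G (src i) (snk j). Poly_Mapping.single p 1)"

definition matrix_bracket ::
    "(('v, 'e, 'k) mor \<Rightarrow> ('v, 'e, 'k) mor \<Rightarrow> ('v, 'e, 'k::field_char_0) tens) \<Rightarrow>
     ('v, 'e, 'k) mor matrix_fn \<Rightarrow> ('v, 'e, 'k) mor matrix_fn \<Rightarrow> ('v, 'e, 'k) tens bimatrix" where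
  "matrix_bracket br X Y i j k l = br (X i j) (Y k l)"

definition LR_product ::
    "('v, 'e, 'k) mor matrix_fn \<Rightarrow> ('v, 'e, 'k) mor matrix_fn \<Rightarrow>
     ('v, 'e, 'k::field_char_0) tens bimatrix" where
  "LR_product X Y i j k l = tensor (X i j) (Y k l)"

definition unit_bimatrix :: "nat \<Rightarrow> nat \<Rightarrow> nat \<Rightarrow> nat \<Rightarrow> 'k::field_char_0 bimatrix" where
  "unit_bimatrix a b c d i j k l = of_bool (i = a \<and> j = b \<and> k = c \<and> l = d)"

definition r_matrix :: "nat \<Rightarrow> 'k::field_char_0 bimatrix" where
  "r_matrix n i j k l =
     (1 / 2) * (\<Sum>(a, b)\<in>{(a, b). 1 \<le> a \<and> a < b \<and> b \<le> n}.
        unit_bimatrix b a a b i j k l - unit_bimatrix a b b a i j k l)"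

definition lmult ::
    "nat \<Rightarrow> 'k bimatrix \<Rightarrow> ('v, 'e, 'k) tens bimatrix \<Rightarrow> ('v, 'e, 'k::field_char_0) tens bimatrix" where
  "lmult m R X i j k l = (\<Sum>p\<in>{1..m}. \<Sum>q\<in>{1..m}. smul (R i p k q) (X p j q l))"

definition rmult ::
    "nat \<Rightarrow> ('v, 'e, 'k) tens bimatrix \<Rightarrow> 'k bimatrix \<Rightarrow> ('v, 'e, 'k::field_char_0) tens bimatrix" where
  "rmult n X R i j k l = (\<Sum>p\<in>{1..n}. \<Sum>q\<in>{1..n}. smul (R p j q l) (X i p k q))"

definition tau_bimatrix ::
    "('v, 'e, 'k) tens bimatrix \<Rightarrow> ('v, 'e, 'k::field_char_0) tens bimatrix" where
  "tau_bimatrix X i j k l = tau (X i j k l)"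

definition bimatrix_diff ::
    "('v, 'e, 'k) tens bimatrix \<Rightarrow> ('v, 'e, 'k) tens bimatrix \<Rightarrow>
     ('v, 'e, 'k::field_char_0) tens bimatrix" where
  "bimatrix_diff X Y i j k l = X i j k l - Y i j k l"

definition twisted_commutator ::
    "nat \<Rightarrow> 'k bimatrix \<Rightarrow> ('v, 'e, 'k) tens bimatrix \<Rightarrow> ('v, 'e, 'k::field_char_0) tens bimatrix" where
  "twisted_commutator n R X = bimatrix_diff (lmult n R X) (tau_bimatrix (rmult n X R))"

definition bimatrix_eq :: "nat \<Rightarrow> nat \<Rightarrow> 'a bimatrix \<Rightarrow> 'a bimatrix \<Rightarrow> bool" where
  "bimatrix_eq m n X Y \<longleftrightarrow>
     (\<forall>i\<in>{1..m}. \<forall>j\<in>{1..n}. \<forall>k\<in>{1..m}. \<forall>l\<in>{1..n}. X i j k l = Y i j k l)"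

end

theory Submission
  imports Defs "HOL-Complex_Analysis.Complex_Analysis"
begin

text \<open>
  By the Leibniz rules, the bracket of two walks is a sum over their meetings at internal vertices,
  where the walks exchange their tails. So \<open>P \<otimes> Q\<close> occurs in the bracket of two boundary
  measurements with the coefficient \<open>\<Sum> \<plusminus> 1/2\<close>, taken over the vertices where \<open>Q\<close> leaves or joins \<open>P\<close>;
  the sign is given by the cyclic order of the edges there. Closed up by an arc outside the disk
  from its sink counterclockwise to its source, \<open>P\<close> becomes a simple closed curve with winding numbers
  \<open>1\<close> to the left and \<open>0\<close> to the right. The signs measure on which side of \<open>P\<close> the edges of \<open>Q\<close>
  lie, so along \<open>Q\<close> the sum telescopes, and only the positions of the end points of \<open>P\<close> and \<open>Q\<close> on the
  circle remain.

  The curves are merely continuous. The cyclic order at a vertex is compared with the winding number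
  by closing the part of \<open>P\<close> inside a small circle by an arc outside of it: near the vertex, the two
  closed curves have winding numbers that differ by a constant, and both take exactly the values
  \<open>0\<close> and \<open>1\<close> there, so the constant vanishes.
\<close>

section \<open>Orientation of triples of points on a circle\<close>

text \<open>Acyclicity makes every walk a simple arc, to which the Jordan curve theorem applies once
  it is closed up, and makes the set of walks between two vertices finite. The exchange of tails at
  a meeting is an involution: a meeting of the given walks \<open>p\<close>, \<open>q\<close> and
  one of the exchanged walks \<open>P\<close>, \<open>Q\<close> determine each other. The bracket
  can therefore be summed with \<open>P\<close>, \<open>Q\<close> fixed and the vertex varying, and
  only in this form does the sum telescope. The factor \<open>1/2\<close> of the bracket is the jump
  between a side of \<open>P\<close> and \<open>P\<close> itself. A stretch common to both walks
  contributes nothing, and the jumps at its two ends add up to \<plusminus> 1 if \<open>Q\<close>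
  crosses \<open>P\<close> there and to 0 if it only touches. A common source or sink lies on
  \<open>P\<close>, halfway between the sides; this is why equal indices contribute 0, as on the
  diagonal of the r-matrices. The obstacle is that the bracket sees cyclic orders near single
  vertices while the end points sit on the boundary circle. Without tangents or smoothness, winding
  numbers have to link the two.\<close>

lemma ccw_points_rotate: "ccw_points a b c \<longleftrightarrow> ccw_points b c a"
  by (simp add: ccw_points_def algebra_simps)

text \<open>Twice the signed area of an inscribed triangle is a product of sines of half the
  differences of the angles. For angles within one turn this reduces orientation to the order of the
  angles.\<close>

lemma Im_cnj_mult_cis:
  "Im (cnj (cis y - cis x) * (cis z - cis x)) =
     4 * sin ((y - x) / 2) * sin ((z - y) / 2) * sin ((z - x) / 2)"
proof -
  define u w where "u = (y - x) / 2" and "w = (z - y) / 2"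
  have y: "y = x + 2 * u" and z: "z = x + 2 * u + 2 * w" and zx: "(z - x) / 2 = u + w"
    by (simp_all add: u_def w_def field_simps)
  have "Im (cnj (cis y - cis x) * (cis z - cis x)) = sin (z - y) - sin (z - x) + sin (y - x)"
    by (simp add: sin_diff algebra_simps)
  also have "\<dots> = sin (2 * w) - sin (2 * (u + w)) + sin (2 * u)"
    by (simp add: y z algebra_simps)
  also have "\<dots> = 4 * sin u * sin w * sin (u + w)"
  proof -
    \<comment> \<open>With the sines and cosines of \<open>u\<close> and \<open>w\<close> as
      variables, the identity is polynomial modulo the two Pythagorean relations.\<close>
    have "2 * S * C - 2 * (s * C + c * S) * (c * C - s * S) + 2 * s * c = 4 * s * S * (s * C + c * S)"
      if "c * c + s * s = 1" "C * C + S * S = 1" for s c S C :: real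
      using that by algebra
    from this[of "cos u" "sin u" "cos w" "sin w"] show ?thesis
      unfolding sin_double sin_add cos_add using sin_cos_squared_add3 by blast
  qed
  finally show ?thesis unfolding zx by (simp add: u_def w_def)
qed

lemma ccw_points_affine:
  assumes "r > 0"
  shows "ccw_points (v + of_real r * a) (v + of_real r * b) (v + of_real r * c) \<longleftrightarrow> ccw_points a b c"
proof -
  have "Im (cnj (v + of_real r * b - (v + of_real r * a)) * (v + of_real r * c - (v + of_real r * a)))
      = r\<^sup>2 * Im (cnj (b - a) * (c - a))"
    by (simp add: algebra_simps power2_eq_square)
  then show ?thesis
    using assms by (simp add: ccw_points_def zero_less_mult_iff)
qed

text \<open>The circle is cut open at \<open>x\<close>: the two sine factors that involve
  \<open>x\<close> are positive, so the sign of the third one decides.\<close>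

lemma ccw_points_cis:
  assumes "x < z" "z < x + 2 * pi" "x < y" "y < x + 2 * pi" "y \<noteq> z"
  shows "ccw_points (cis x) (cis y) (cis z) \<longleftrightarrow> y < z"
proof -
  have "sin ((y - x) / 2) > 0" "sin ((z - x) / 2) > 0"
    using assms by (auto intro!: sin_gt_zero)
  moreover have "sin ((z - y) / 2) > 0 \<longleftrightarrow> y < z"
  proof (cases "y < z")
    case True
    then have "sin ((z - y) / 2) > 0"
      using assms by (intro sin_gt_zero) auto
    then show ?thesis using True by simp
  next
    case False
    then have "sin ((y - z) / 2) > 0"
      using assms by (intro sin_gt_zero) auto
    moreover have "sin ((z - y) / 2) = - sin ((y - z) / 2)"
      by (metis minus_diff_eq minus_divide_left sin_minus)
    ultimately show ?thesis using False by simp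
  qed
  ultimately show ?thesis
    unfolding ccw_points_def Im_cnj_mult_cis by (simp add: zero_less_mult_iff)
qed

lemma obtain_angle:
  assumes "p \<in> sphere v r" "r > 0"
  obtains t where "p = v + of_real r * cis t" "x \<le> t" "t < x + 2 * pi"
proof -
  define s where "s = Arg ((p - v) / cis x)"
  have "norm ((p - v) / cis x) = r"
    using assms by (simp add: norm_divide dist_norm norm_minus_commute)
  then have "(p - v) / cis x = of_real r * cis s"
    using Arg_eq[of "(p - v) / cis x"] assms(2) unfolding s_def
    by (metis cis_conv_exp norm_zero order_less_irrefl)
  then have p: "p = v + of_real r * cis (x + s)"
    by (simp add: field_simps cis_mult)
  have s: "- pi < s" "s \<le> pi" unfolding s_def by (auto simp: mpi_less_Arg Arg_le_pi)
  show thesis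
  proof (cases "s \<ge> 0")
    case True
    have "s < 2 * pi" using s pi_gt_zero by linarith
    then show ?thesis using that[of "x + s"] p True by simp
  next
    case False
    have "cis (x + s + 2 * pi) = cis (x + s)"
      by (simp flip: cis_mult)
    then have "p = v + of_real r * cis (x + s + 2 * pi)" using p by simp
    moreover have "s + 2 * pi > 0" using s pi_gt_zero by linarith
    ultimately show ?thesis using that[of "x + s + 2 * pi"] False
      by (simp add: add.assoc)
  qed
qed

lemma obtain_two_angles:
  assumes "a \<in> sphere v r" "b \<in> sphere v r" "a \<noteq> b" "r > 0"
  obtains x z where "a = v + of_real r * cis x" "b = v + of_real r * cis z"
    "x < z" "z < x + 2 * pi"
proof -
  obtain x where x: "a = v + of_real r * cis x" using obtain_angle[OF assms(1,4), of 0] by blast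
  obtain z where z: "b = v + of_real r * cis z" "x \<le> z" "z < x + 2 * pi"
    using obtain_angle[OF assms(2,4), of x] by blast
  with assms(3) x have "x \<noteq> z" by auto
  then show ?thesis using that[OF x z(1)] z by simp
qed

lemma obtain_third_angle:
  assumes "c \<in> sphere v r" "r > 0"
    "c \<noteq> v + of_real r * cis x" "c \<noteq> v + of_real r * cis z"
  obtains y where "c = v + of_real r * cis y" "x < y" "y < x + 2 * pi" "y \<noteq> z"
proof -
  obtain y where y: "c = v + of_real r * cis y" "x \<le> y" "y < x + 2 * pi"
    using obtain_angle[OF assms(1,2), of x] by blast
  with assms(3,4) have "x \<noteq> y" "y \<noteq> z" by auto
  then show ?thesis using that[of y] y by simp
qed

lemma ccw_points_sphere_cases:
  assumes "a \<in> sphere v r" "b \<in> sphere v r" "c \<in> sphere v r" "r > 0"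
    "a \<noteq> b" "b \<noteq> c" "a \<noteq> c"
  shows "ccw_points a b c \<longleftrightarrow> \<not> ccw_points a c b"
proof -
  obtain x z where xz: "a = v + of_real r * cis x" "b = v + of_real r * cis z"
    "x < z" "z < x + 2 * pi"
    using obtain_two_angles[of a v r b] assms by metis
  obtain y where y: "c = v + of_real r * cis y" "x < y" "y < x + 2 * pi" "y \<noteq> z"
    using obtain_third_angle[of c v r x z] assms xz by metis
  show ?thesis
    using xz y assms(4) by (auto simp: ccw_points_affine ccw_points_cis)
qed


section \<open>Closing an arc of a disk outside the disk\<close>

text \<open>A detour out along one ray, along the circle of twice the radius and back in along
  another ray. Its parameters are angles rather than points, so that the same end points can be
  joined both ways around the disk, with \<open>z\<close> or with \<open>z - 2 * pi\<close>.\<close>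

definition collar :: "complex \<Rightarrow> real \<Rightarrow> real \<Rightarrow> real \<Rightarrow> real \<Rightarrow> complex" where
  "collar v r x z =
     linepath (v + of_real r * cis x) (v + of_real (2 * r) * cis x) +++
     part_circlepath v (2 * r) x z +++
     linepath (v + of_real (2 * r) * cis z) (v + of_real r * cis z)"

lemma path_collar [simp]: "path (collar v r x z)"
  by (auto simp: collar_def cis_conv_exp)

lemma pathstart_collar [simp]: "pathstart (collar v r x z) = v + of_real r * cis x"
  and pathfinish_collar [simp]: "pathfinish (collar v r x z) = v + of_real r * cis z"
  by (simp_all add: collar_def)

lemma radial_segment:
  "closed_segment (v + of_real p * cis t) (v + of_real q * cis t) =
     (\<lambda>s. v + of_real s * cis t) ` closed_segment p q"
proof -
  have "(1 - u) *\<^sub>R (v + of_real p * cis t) + u *\<^sub>R (v + of_real q * cis t) =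
      v + of_real ((1 - u) *\<^sub>R p + u *\<^sub>R q) * cis t" for u
    by (simp add: scaleR_conv_of_real algebra_simps)
  then show ?thesis
    by (simp only: closed_segment_image_interval image_image)
qed

lemma path_image_collar:
  assumes "r > 0"
  shows "path_image (collar v r x z) =
    (\<lambda>s. v + of_real s * cis x) ` {r..2*r} \<union> (\<lambda>t. v + of_real (2*r) * cis t) ` closed_segment x z
     \<union> (\<lambda>s. v + of_real s * cis z) ` {r..2*r}"
proof -
  have "closed_segment (2*r) r = {r..2*r}" "closed_segment r (2*r) = {r..2*r}"
    using assms by (auto simp: closed_segment_eq_real_ivl)
  then show ?thesis
    unfolding collar_def using radial_segment
    by (subst path_image_join path_image_linepath |
        simp add: cis_conv_exp[symmetric] path_image_part_circlepath' radial_segment Un_assoc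
             del: of_real_mult)+
qed

lemma polar_eq_iff:
  assumes "p > 0" "q > 0"
  shows "of_real p * cis s = of_real q * cis t \<longleftrightarrow> p = q \<and> cis s = cis t"
proof
  assume *: "of_real p * cis s = of_real q * cis t"
  then have "norm (of_real p * cis s) = norm (of_real q * cis t)" by simp
  then have "p = q" using assms by (simp add: norm_mult)
  then show "p = q \<and> cis s = cis t" using * assms by simp
qed auto

lemma cis_neq:
  assumes "s \<noteq> t" "\<bar>s - t\<bar> < 2 * pi"
  shows "cis s \<noteq> cis t"
proof
  assume "cis s = cis t"
  then have "cis (s - t) = 1"
    by (metis cis_divide cis_neq_zero divide_self)
  then have "cos (s - t) = 1"
    by (metis cis.simps(1) one_complex.simps(1))
  then obtain n :: int where n: "s - t = of_int n * 2 * pi"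
    using cos_one_2pi_int by blast
  then have "\<bar>of_int n\<bar> * (2 * pi) < 2 * pi"
    using assms by (simp add: abs_mult)
  then have "\<bar>of_int n :: real\<bar> < 1" by simp
  then have "n = 0" by linarith
  then show False using n assms(1) by simp
qed

lemma arc_collar:
  assumes "r > 0" "x \<noteq> z" "\<bar>x - z\<bar> < 2 * pi"
  shows "arc (collar v r x z)"
proof -
  have ne: "cis x \<noteq> cis z" using cis_neq assms by blast
  have seg: "closed_segment r (2*r) = {r..2*r}" "closed_segment (2*r) r = {r..2*r}"
    using assms by (auto simp: closed_segment_eq_real_ivl)
  have l: "arc (linepath (v + of_real r * cis t) (v + of_real (2*r) * cis t))"
    "arc (linepath (v + of_real (2*r) * cis t) (v + of_real r * cis t))" for t
    using assms(1) by (auto intro!: arc_linepath simp del: of_real_mult simp: polar_eq_iff)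
  have p: "arc (part_circlepath v (2*r) x z)"
    using assms by (intro arc_part_circlepath) auto
  have im: "path_image (part_circlepath v (2*r) x z) =
      (\<lambda>t. v + of_real (2*r) * cis t) ` closed_segment x z"
    by (simp add: path_image_part_circlepath')
  have pl: "arc (part_circlepath v (2*r) x z +++
     linepath (v + of_real (2 * r) * cis z) (v + of_real r * cis z))"
  proof (rule arc_join[OF p l(2)])
    show "path_image (part_circlepath v (2*r) x z) \<inter>
      path_image (linepath (v + of_real (2 * r) * cis z) (v + of_real r * cis z))
      \<subseteq> {pathstart (linepath (v + of_real (2 * r) * cis z) (v + of_real r * cis z))}"
      unfolding im path_image_linepath radial_segment seg pathstart_linepath
      using assms(1) by (auto simp: polar_eq_iff simp del: of_real_mult)
  qed (simp add: cis_conv_exp)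
  show ?thesis
    unfolding collar_def
  proof (rule arc_join[OF l(1) pl])
    have "path_image (part_circlepath v (2 * r) x z +++
          linepath (v + of_real (2 * r) * cis z) (v + of_real r * cis z))
       = path_image (part_circlepath v (2 * r) x z) \<union>
          path_image (linepath (v + of_real (2 * r) * cis z) (v + of_real r * cis z))"
      by (rule path_image_join) (simp add: cis_conv_exp)
    then show "path_image (linepath (v + of_real r * cis x) (v + of_real (2 * r) * cis x)) \<inter>
      path_image (part_circlepath v (2 * r) x z +++
          linepath (v + of_real (2 * r) * cis z) (v + of_real r * cis z))
      \<subseteq> {pathstart (part_circlepath v (2 * r) x z +++
          linepath (v + of_real (2 * r) * cis z) (v + of_real r * cis z))}"
      unfolding im path_image_linepath radial_segment seg
      using assms(1) ne by (auto simp: polar_eq_iff cis_conv_exp[symmetric] simp del: of_real_mult)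
  qed (simp add: cis_conv_exp)
qed

lemma collar_meets_disk:
  assumes "r > 0"
  shows "path_image (collar v r x z) \<inter> cball v r = {v + of_real r * cis x, v + of_real r * cis z}"
proof -
  have "dist v (v + of_real s * cis t) = \<bar>s\<bar>" for s t
    by (simp add: dist_norm norm_mult)
  then show ?thesis
    using assms by (auto simp: path_image_collar simp del: of_real_mult)
qed

text \<open>The two arcs starting at angle \<open>x\<close> differ by the full circle from
  \<open>z - 2 * pi\<close> to \<open>z\<close>, which passes \<open>x\<close> on its way and winds
  once around each point of the disk.\<close>

lemma winding_number_part_circlepath_diff:
  assumes "x < z" "z < x + 2 * pi" "w \<in> ball v r"
  shows "winding_number (part_circlepath v r x z) w
       - winding_number (part_circlepath v r x (z - 2 * pi)) w = 1"
proof -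
  have r: "r > 0" using assms(3) by (metis ball_eq_empty empty_iff not_le)
  have no: "norm (w - v) < r" using assms(3) by (simp add: dist_norm norm_minus_commute)
  have notin: "w \<notin> path_image (part_circlepath v r s t)" for s t
    using path_image_part_circlepath_subset'[of r v s t] r assms(3) by auto
  define q where "q = part_circlepath v r (z - 2 * pi) z"
  have q: "path q" "w \<notin> path_image q" "pathfinish q = pathstart q"
    using notin by (auto simp: q_def simp flip: cis_conv_exp of_real_diff cis_divide)
  have wq: "winding_number q w = 1"
  proof (rule simple_closed_path_winding_number_pos)
    show "simple_path q" using r by (simp add: q_def simple_path_part_circlepath)
    show "0 < Re (winding_number q w)"
      unfolding q_def by (rule winding_number_part_circlepath_pos_less) (use no in auto)
  qed (use q in auto)
  \<comment> \<open>\<open>u\<close> is the parameter at which the full circle \<open>q\<close>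
    reaches the angle \<open>x\<close>.\<close>
  define u where "u = (x - (z - 2 * pi)) / (2 * pi)"
  have u: "u \<in> {0..1}" using assms by (simp add: u_def field_simps)
  have u2: "u * (2 * pi) = x - (z - 2 * pi)" by (simp add: u_def)
  have "linepath (z - 2 * pi) z (u * t) = linepath (z - 2 * pi) x t" for t
    using arg_cong[OF u2, of "\<lambda>q. q * t"] by (simp add: linepath_def algebra_simps)
  then have q0: "subpath 0 u q = part_circlepath v r (z - 2 * pi) x"
    by (simp add: subpath_def q_def part_circlepath_def)
  have "linepath (z - 2 * pi) z ((1 - u) * t + u) = linepath x z t" for t
    using arg_cong[OF u2, of "\<lambda>q. q * t"] u2 by (simp add: linepath_def algebra_simps)
  then have q1: "subpath u 1 q = part_circlepath v r x z"
    by (simp add: subpath_def q_def part_circlepath_def)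
  have "winding_number (subpath 0 u q) w + winding_number (subpath u 1 q) w =
      winding_number (subpath 0 1 q) w"
    using q u by (intro winding_number_subpath_combine) auto
  moreover have "winding_number (part_circlepath v r x (z - 2 * pi)) w
    = - winding_number (part_circlepath v r (z - 2 * pi) x) w"
    using winding_number_reversepath[of "part_circlepath v r (z - 2 * pi) x" w] notin by simp
  ultimately show ?thesis by (simp add: wq q0 q1 add.commute)
qed


lemma notin_collar:
  assumes "r > 0" "r \<le> s" "s < 2 * r" "cis y \<noteq> cis x" "cis y \<noteq> cis z"
  shows "v + of_real s * cis y \<notin> path_image (collar v r x z)"
  using assms by (auto simp: path_image_collar polar_eq_iff simp del: of_real_mult)

text \<open>If the angle \<open>y\<close> is not swept by the collar, the radial ray from the point
  escapes to infinity without meeting the loop. The radius \<open>3 * r\<close> is merely one beyond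
  that of the collar.\<close>

lemma winding_number_collar_far:
  assumes r: "r > 0" and p: "path p" "path_image p \<subseteq> cball v r"
    "pathstart p = v + of_real r * cis z" "pathfinish p = v + of_real r * cis x"
    and y: "\<And>t. t \<in> closed_segment x z \<Longrightarrow> cis y \<noteq> cis t"
    and s: "r \<le> s" "s < 2 * r" "v + of_real s * cis y \<notin> path_image p"
  shows "winding_number (p +++ collar v r x z) (v + of_real s * cis y) = 0"
proof -
  let ?ray = "(\<lambda>q. v + of_real q * cis y) ` {s..3*r}"
  have dist: "dist v (v + of_real q * cis t) = \<bar>q\<bar>" for q t
    by (simp add: dist_norm norm_mult)
  have loop: "path (p +++ collar v r x z)" "pathfinish (p +++ collar v r x z) = pathstart (p +++ collar v r x z)"
    using p by (auto intro!: path_join_imp)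
  have im: "path_image (p +++ collar v r x z) = path_image p \<union> path_image (collar v r x z)"
    using p by (intro path_image_join) simp
  have "v + of_real q * cis y \<notin> path_image p" if "s \<le> q" for q
  proof (cases "q = r")
    case True
    then show ?thesis using s that by simp
  next
    case False
    then have "v + of_real q * cis y \<notin> cball v r" using that s r by (simp add: dist)
    then show ?thesis using p by blast
  qed
  moreover have "v + of_real q * cis y \<notin> path_image (collar v r x z)" if "s \<le> q" for q
    using y[of x] y[of z] y r s that by (auto simp: path_image_collar polar_eq_iff simp del: of_real_mult)
  ultimately have disj: "?ray \<inter> path_image (p +++ collar v r x z) = {}"
    unfolding im by auto
  have "winding_number (p +++ collar v r x z) (v + of_real s * cis y) =
        winding_number (p +++ collar v r x z) (v + of_real (3*r) * cis y)"
  proof (rule winding_number_eq[OF loop _ _ _ disj])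
    show "topological_space_class.connected ?ray"
      by (intro connected_continuous_image continuous_intros connected_Icc)
    show "v + of_real s * cis y \<in> ?ray" using s r by (intro imageI) auto
    show "v + of_real (3*r) * cis y \<in> ?ray" using s r by (intro imageI) auto
  qed
  also have "\<dots> = 0"
  proof (rule winding_number_zero_outside[OF loop(1) convex_cball loop(2)])
    show "v + of_real (3*r) * cis y \<notin> cball v (2*r)"
      using r by (simp add: dist del: of_real_mult)
    have "path_image (collar v r x z) \<subseteq> cball v (2*r)"
      using r by (auto simp: path_image_collar dist simp del: of_real_mult)
    then show "path_image (p +++ collar v r x z) \<subseteq> cball v (2*r)"
      using p r unfolding im by auto
  qed
  finally show ?thesis .
qed

text \<open>
  For \<open>y < z\<close> the collar is compared with the one running the other way around, of angles \<open>x\<close> and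
  \<open>z - 2 * pi\<close>, outside of which the point lies.
\<close>

lemma winding_number_collar:
  assumes r: "r > 0" and p: "path p" "path_image p \<subseteq> cball v r"
    "pathstart p = v + of_real r * cis z" "pathfinish p = v + of_real r * cis x"
    and xz: "x < z" "z < x + 2 * pi" and y: "x < y" "y < x + 2 * pi" "y \<noteq> z"
    and s: "r \<le> s" "s < 2 * r" "v + of_real s * cis y \<notin> path_image p"
  shows "winding_number (p +++ collar v r x z) (v + of_real s * cis y) = of_bool (y < z)"
proof (cases "y < z")
  case False
  have "winding_number (p +++ collar v r x z) (v + of_real s * cis y) = 0"
  proof (rule winding_number_collar_far[OF r p _ s])
    show "cis y \<noteq> cis t" if "t \<in> closed_segment x z" for t
      using that False xz y by (intro cis_neq) (auto simp: closed_segment_eq_real_ivl)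
  qed
  then show ?thesis using False by simp
next
  case True
  let ?w = "v + of_real s * cis y"
  have cz: "cis (z - 2 * pi) = cis z" by (simp flip: cis_divide)
  have "winding_number (p +++ collar v r x (z - 2 * pi)) ?w = 0"
  proof (rule winding_number_collar_far[OF r p(1,2) _ p(4) _ s])
    show "cis y \<noteq> cis t" if "t \<in> closed_segment x (z - 2 * pi)" for t
      using that True xz y by (intro cis_neq) (auto simp: closed_segment_eq_real_ivl split: if_splits)
    show "pathstart p = v + of_real r * cis (z - 2 * pi)" using p cz by simp
  qed
  moreover have ne: "cis y \<noteq> cis x" "cis y \<noteq> cis z"
    using cis_neq[of y x] cis_neq[of y z] xz y by (auto simp: abs_if)
  have n: "?w \<notin> path_image (collar v r x z)" "?w \<notin> path_image (collar v r x (z - 2 * pi))"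
    using notin_collar[OF r s(1,2)] ne cz by auto
  have wp: "winding_number (p +++ collar v r x t) ?w = winding_number p ?w + winding_number (collar v r x t) ?w"
    if "t = z \<or> t = z - 2 * pi" for t
    using that n p s by (intro winding_number_join) auto
  have n1: "?w \<notin> path_image (linepath (v + of_real r * cis t) (v + of_real (2 * r) * cis t))"
    "?w \<notin> path_image (linepath (v + of_real (2 * r) * cis t) (v + of_real r * cis t))" if "cis t \<noteq> cis y" for t
    using that r s unfolding path_image_linepath radial_segment
    by (auto simp: closed_segment_eq_real_ivl polar_eq_iff simp del: of_real_mult)
  have n2: "?w \<notin> path_image (part_circlepath v (2 * r) x t)" for t
    unfolding path_image_part_circlepath' using r s
    by (auto simp: polar_eq_iff simp del: of_real_mult)
  have wc: "winding_number (collar v r x t) ?w =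
      winding_number (linepath (v + of_real r * cis x) (v + of_real (2 * r) * cis x)) ?w
    + (winding_number (part_circlepath v (2 * r) x t) ?w
    +  winding_number (linepath (v + of_real (2 * r) * cis t) (v + of_real r * cis t)) ?w)"
    if "cis t \<noteq> cis y" for t
  proof -
    have i: "path_image (part_circlepath v (2 * r) x t +++
        linepath (v + of_real (2 * r) * cis t) (v + of_real r * cis t))
      = path_image (part_circlepath v (2 * r) x t) \<union>
        path_image (linepath (v + of_real (2 * r) * cis t) (v + of_real r * cis t))"
      by (rule path_image_join) (simp add: cis_conv_exp)
    show ?thesis
      unfolding collar_def using n1[OF that] n1[of x] ne n2 i
      by (subst winding_number_join | simp add: cis_conv_exp[symmetric])+
  qed
  \<comment> \<open>The radial parts of the two collars coincide, because
    \<open>cis (z - 2 * pi) = cis z\<close>; only the circular parts contribute to the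
    difference.\<close>
  have "winding_number (part_circlepath v (2 * r) x z) ?w
       - winding_number (part_circlepath v (2 * r) x (z - 2 * pi)) ?w = 1"
    using r s by (intro winding_number_part_circlepath_diff xz) (simp add: dist_norm norm_mult)
  ultimately show ?thesis
    using wp[of z] wp[of "z - 2 * pi"] wc[of z] wc[of "z - 2 * pi"] ne cz True
    by (simp add: algebra_simps)
qed

text \<open>The collar runs counterclockwise from the end of \<open>p\<close> to its start, which
  gives the left side of \<open>p\<close> the value 1. The last property holds because every point
  of a Jordan curve is in the frontier of both the inside and the outside; it serves to exclude a
  constant shift between two winding numbers.\<close>

lemma disk_closing:
  assumes r: "r > 0" and arc: "arc p" and sub: "path_image p \<subseteq> cball v r"
    and ends: "pathstart p \<in> sphere v r" "pathfinish p \<in> sphere v r"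
  obtains c where "path c" "pathstart c = pathfinish p" "pathfinish c = pathstart p"
    "path_image c \<inter> cball v r = {pathstart p, pathfinish p}"
    "\<And>w. w \<notin> path_image p \<Longrightarrow> w \<notin> path_image c \<Longrightarrow> winding_number (p +++ c) w \<in> {0, 1}"
    "\<And>w. w \<in> sphere v r \<Longrightarrow> w \<notin> path_image p \<Longrightarrow>
        winding_number (p +++ c) w = of_bool (ccw_points (pathfinish p) w (pathstart p))"
    "\<And>q e i. q \<in> path_image p \<Longrightarrow> e > 0 \<Longrightarrow> i \<in> {0, 1} \<Longrightarrow>
        \<exists>w\<in>ball q e. w \<notin> path_image p \<and> w \<notin> path_image c \<and> winding_number (p +++ c) w = i"
proof -
  have "pathfinish p \<noteq> pathstart p" using arc by (metis arc_distinct_ends)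
  then obtain x z where xz: "pathfinish p = v + of_real r * cis x" "pathstart p = v + of_real r * cis z"
    "x < z" "z < x + 2 * pi"
    using obtain_two_angles[OF ends(2,1) _ r] by blast
  define c where "c = collar v r x z"
  have p: "path p" using arc by (rule arc_imp_path)
  have c: "path c" "pathstart c = pathfinish p" "pathfinish c = pathstart p"
    by (simp_all add: c_def xz)
  have meet: "path_image c \<inter> cball v r = {pathstart p, pathfinish p}"
    using collar_meets_disk[OF r] by (auto simp: c_def xz)
  have simple: "simple_path (p +++ c)"
  proof (rule simple_path_join_loop[OF arc])
    show "arc c" unfolding c_def using xz by (intro arc_collar r) auto
    show "path_image p \<inter> path_image c \<subseteq> {pathstart p, pathstart c}"
      using meet sub c by auto
  qed (use c in auto)
  have loop: "pathfinish (p +++ c) = pathstart (p +++ c)" using c by simp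
  have im: "path_image (p +++ c) = path_image p \<union> path_image c"
    using c by (intro path_image_join) simp
  \<comment> \<open>\<open>?w\<close> lies in the gap between the disk and the circle of radius
    \<open>2 * r\<close>, in the middle of the sector swept by the collar. Its winding number 1
    rules out the value \<open>- 1\<close> for the inside of the Jordan curve.\<close>
  let ?y = "(x + z) / 2" and ?s = "3 / 2 * r"
  let ?w = "v + of_real ?s * cis ?y"
  have "?w \<notin> cball v r" using r by (simp add: dist_norm norm_mult)
  then have wp: "?w \<notin> path_image p" using sub by blast
  have y: "x < ?y" "?y < z" "?y < x + 2 * pi"
    using xz pi_gt_zero by (simp_all add: field_simps)
  have "cis ?y \<noteq> cis x" "cis ?y \<noteq> cis z"
    using y xz by (intro cis_neq; linarith)+
  then have wc: "?w \<notin> path_image c" unfolding c_def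
    using r by (intro notin_collar) auto
  have "winding_number (p +++ c) ?w = 1"
    unfolding c_def using winding_number_collar[OF r p sub xz(2,1,3,4), of ?y ?s] wp xz r by simp
  then have "?w \<in> inside (path_image (p +++ c))"
    using winding_number_zero_in_outside[of "p +++ c" ?w] inside_Un_outside[of "path_image (p +++ c)"]
      wp wc simple loop im simple_path_imp_path by fastforce
  then have ins: "winding_number (p +++ c) w = 1" if "w \<in> inside (path_image (p +++ c))" for w
    using simple_closed_path_winding_number_inside[OF simple] that \<open>winding_number (p +++ c) ?w = 1\<close>
    by (metis one_neq_neg_one)
  have out: "winding_number (p +++ c) w = 0" if "w \<in> outside (path_image (p +++ c))" for w
    using winding_number_zero_in_outside[OF simple_path_imp_path[OF simple] loop that] .
  show thesis
  proof (rule that[OF c meet])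
    fix w assume "w \<notin> path_image p" "w \<notin> path_image c"
    then have "w \<in> inside (path_image (p +++ c)) \<union> outside (path_image (p +++ c))"
      using im inside_Un_outside by blast
    then show "winding_number (p +++ c) w \<in> {0, 1}" by (elim UnE) (simp_all add: ins out)
  next
    fix w assume w: "w \<in> sphere v r" "w \<notin> path_image p"
    then have "w \<noteq> pathfinish p" "w \<noteq> pathstart p" by auto
    then obtain y where y: "w = v + of_real r * cis y" "x < y" "y < x + 2 * pi" "y \<noteq> z"
      using obtain_third_angle[OF w(1) r] xz by metis
    have "winding_number (p +++ c) w = of_bool (y < z)"
      unfolding c_def y(1) using xz y w r p sub by (intro winding_number_collar) auto
    moreover have "ccw_points (pathfinish p) w (pathstart p) \<longleftrightarrow> y < z"
      unfolding xz y(1) ccw_points_affine[OF r] using xz y by (intro ccw_points_cis) auto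
    ultimately show "winding_number (p +++ c) w = of_bool (ccw_points (pathfinish p) w (pathstart p))"
      by simp
  next
    fix q :: complex and e :: real and i :: complex
    assume q: "q \<in> path_image p" and e: "e > 0" and i: "i \<in> {0, 1}"
    have J: "frontier (inside (path_image (p +++ c))) = path_image (p +++ c)"
      "frontier (outside (path_image (p +++ c))) = path_image (p +++ c)"
      using Jordan_inside_outside[OF simple loop] by auto
    have "q \<in> closure (inside (path_image (p +++ c)))" "q \<in> closure (outside (path_image (p +++ c)))"
      using q im J by (auto simp: frontier_def)
    then obtain w1 w0 where w: "w1 \<in> inside (path_image (p +++ c))" "dist w1 q < e"
      "w0 \<in> outside (path_image (p +++ c))" "dist w0 q < e"
      using e unfolding closure_approachable by meson
    moreover have "w1 \<notin> path_image (p +++ c)" "w0 \<notin> path_image (p +++ c)"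
      using w inside_no_overlap outside_no_overlap by blast+
    ultimately show "\<exists>w\<in>ball q e. w \<notin> path_image p \<and> w \<notin> path_image c \<and> winding_number (p +++ c) w = i"
      using ins out i im by (auto simp: dist_commute)
  qed
qed


section \<open>The side of a third curve at a point of a closed curve\<close>

text \<open>The set of hitting parameters is closed and, by the intermediate value theorem,
  nonempty, so its infimum is attained. A point at a larger distance before it would force an
  earlier hit.\<close>

lemma first_hit_obtain:
  assumes g: "path g" "pathstart g = v" and e: "0 < e" "e < dist v (pathfinish g)"
  obtains t where "0 < t" "t < 1" "first_hit g e = g t" "g t \<in> sphere v e" "g ` {0..t} \<subseteq> cball v e"
proof -
  define d where "d s = dist (g 0) (g s)" for s
  have v: "g 0 = v" using g by (simp add: pathstart_def)
  have cont: "continuous_on {0..1} d"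
    unfolding d_def using g(1) by (intro continuous_intros) (simp add: path_def)
  define A where "A = {t \<in> {0..1}. d t = e}"
  have A: "closed A" unfolding A_def
    by (rule continuous_closed_preimage_constant[OF cont]) simp
  have hit: "\<exists>t\<in>A. t \<le> s" if "0 \<le> s" "s \<le> 1" "e \<le> d s" for s
  proof -
    have "\<exists>t\<ge>0. t \<le> s \<and> d t = e"
      using that e cont by (intro IVT') (auto simp: d_def intro: continuous_on_subset)
    then show ?thesis using that by (force simp: A_def)
  qed
  have "d 1 \<ge> e" using e v by (simp add: d_def pathfinish_def)
  then have ne: "A \<noteq> {}" using hit[of 1] by auto
  have bdd: "bdd_below A" by (rule bdd_belowI[of _ 0]) (simp add: A_def)
  define t where "t = Inf A"
  have "t \<in> A" unfolding t_def using closed_contains_Inf ne bdd A by blast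
  then have t: "0 \<le> t" "t \<le> 1" "d t = e" by (auto simp: A_def)
  have "t \<noteq> 0" "t \<noteq> 1" using t e v by (auto simp: d_def pathfinish_def)
  moreover have "first_hit g e = g t" by (simp add: first_hit_def t_def A_def d_def)
  moreover have "d s \<le> e" if "0 \<le> s" "s \<le> t" for s
  proof (rule ccontr)
    assume "\<not> d s \<le> e"
    then have "\<exists>t'\<in>A. t' \<le> s" using that t by (intro hit) auto
    then obtain t' where "t' \<in> A" "t' \<le> s" by blast
    moreover have "t \<le> t'" unfolding t_def using \<open>t' \<in> A\<close> bdd by (rule cInf_lower)
    ultimately have "s = t" using that \<open>t' \<le> s\<close> by simp
    then show False using t \<open>\<not> d s \<le> e\<close> by simp
  qed
  ultimately show thesis
    using that[of t] t v by (force simp: d_def)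
qed

text \<open>The parts \<open>x2\<close> and \<open>y1\<close> of the curves next to
  \<open>v\<close>, up to the circle of radius \<open>e\<close>, are closed by a collar to
  \<open>p +++ c\<close>; the other parts and the reversed collar form \<eta>. The remote parts
  \<open>x1\<close> and \<open>y2\<close> may re-enter the circle, so only a smaller ball around
  \<open>v\<close> is sure to avoid \<eta>. Hence the comparison is made in that ball, and the point
  is carried there and back to the circle along \<open>g\<close>. Every radius below the three
  distances works; no limit is taken.\<close>

lemma ccw_first_hit_eq_winding_number:
  assumes x: "arc x" "pathfinish x = v" and y: "arc y" "pathstart y = v"
    and xy: "path_image x \<inter> path_image y \<subseteq> {v}"
    and \<rho>: "path \<rho>" "pathstart \<rho> = pathfinish y" "pathfinish \<rho> = pathstart x" "v \<notin> path_image \<rho>"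
    and W01: "\<And>w. w \<notin> path_image x \<union> path_image y \<union> path_image \<rho> \<Longrightarrow>
      winding_number x w + winding_number y w + winding_number \<rho> w \<in> {0, 1}"
    and g: "arc g" "pathstart g = v"
    and g_off: "\<And>s. 0 < s \<Longrightarrow> s < 1 \<Longrightarrow> g s \<notin> path_image x \<union> path_image y \<union> path_image \<rho>"
    and s: "0 < s" "s < 1"
    and e: "0 < e" "e < dist v (pathstart x)" "e < dist v (pathfinish y)" "e < dist v (pathfinish g)"
  shows "winding_number x (g s) + winding_number y (g s) + winding_number \<rho> (g s) =
     of_bool (ccw_points (first_hit y e) (first_hit g e) (first_hit (reversepath x) e))"
proof -
  define W where "W w = winding_number x w + winding_number y w + winding_number \<rho> w" for w
  have paths: "path x" "path y" "path g" using x y g by (auto intro: arc_imp_path)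
  have v: "x 1 = v" "y 0 = v" "g 0 = v" using x y g by (auto simp: pathstart_def pathfinish_def)
  have inj: "inj_on x {0..1}" "inj_on y {0..1}" using x y by (auto simp: arc_def)
  obtain t' where t': "0 < t'" "t' < 1" "first_hit (reversepath x) e = reversepath x t'"
    "reversepath x t' \<in> sphere v e" "reversepath x ` {0..t'} \<subseteq> cball v e"
    using first_hit_obtain[of "reversepath x" v e] paths x e by auto
  define tx where "tx = 1 - t'"
  have tx: "0 < tx" "tx < 1" "first_hit (reversepath x) e = x tx" "x tx \<in> sphere v e"
    using t' by (auto simp: tx_def reversepath_def)
  have xball: "x ` {tx..1} \<subseteq> cball v e"
  proof -
    have "x u = reversepath x (1 - u)" for u by (simp add: reversepath_def)
    then show ?thesis using t'(5) unfolding tx_def by force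
  qed
  obtain ty where ty: "0 < ty" "ty < 1" "first_hit y e = y ty" "y ty \<in> sphere v e" "y ` {0..ty} \<subseteq> cball v e"
    using first_hit_obtain[of y v e] paths y e by auto
  obtain tg where tg: "0 < tg" "tg < 1" "first_hit g e = g tg" "g tg \<in> sphere v e" "g ` {0..tg} \<subseteq> cball v e"
    using first_hit_obtain[of g v e] paths g e by auto
  define x1 x2 y1 y2 where "x1 = subpath 0 tx x" and "x2 = subpath tx 1 x"
    and "y1 = subpath 0 ty y" and "y2 = subpath ty 1 y"
  have imx: "path_image x1 = x ` {0..tx}" "path_image x2 = x ` {tx..1}"
    and imy: "path_image y1 = y ` {0..ty}" "path_image y2 = y ` {ty..1}"
    using tx ty by (simp_all add: x1_def x2_def y1_def y2_def path_image_subpath)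
  have sub: "path_image x1 \<subseteq> path_image x" "path_image x2 \<subseteq> path_image x"
      "path_image y1 \<subseteq> path_image y" "path_image y2 \<subseteq> path_image y"
    using tx ty unfolding imx imy by (auto simp: path_image_def)
  have pp: "path x1" "path x2" "path y1" "path y2"
    using tx ty paths by (simp_all add: x1_def x2_def y1_def y2_def)
  have ends: "pathstart x1 = pathstart x" "pathfinish x1 = x tx" "pathstart x2 = x tx" "pathfinish x2 = v"
    "pathstart y1 = v" "pathfinish y1 = y ty" "pathstart y2 = y ty" "pathfinish y2 = pathfinish y"
    using x y v by (auto simp: x1_def x2_def y1_def y2_def pathstart_def pathfinish_def subpath_def)
  define p where "p = x2 +++ y1"
  have imp: "path_image p = path_image x2 \<union> path_image y1"
    unfolding p_def using ends by (intro path_image_join) simp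
  have "arc p" unfolding p_def
  proof (rule arc_join)
    show "arc x2" unfolding x2_def using x tx by (intro arc_subpath_arc) auto
    show "arc y1" unfolding y1_def using y ty by (intro arc_subpath_arc) auto
    show "path_image x2 \<inter> path_image y1 \<subseteq> {pathstart y1}" using xy sub ends by auto
  qed (use ends in auto)
  have pball: "path_image p \<subseteq> cball v e" using imp imx imy xball ty by auto
  have pends: "pathstart p = x tx" "pathfinish p = y ty" by (simp_all add: p_def ends)
  obtain c where c: "path c" "pathstart c = pathfinish p" "pathfinish c = pathstart p"
    "path_image c \<inter> cball v e = {pathstart p, pathfinish p}"
    and wn_sphere: "\<And>w. w \<in> sphere v e \<Longrightarrow> w \<notin> path_image p \<Longrightarrow>
        winding_number (p +++ c) w = of_bool (ccw_points (pathfinish p) w (pathstart p))"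
    and wn_near: "\<And>q d i. q \<in> path_image p \<Longrightarrow> d > 0 \<Longrightarrow> i \<in> {0, 1} \<Longrightarrow>
        \<exists>w\<in>ball q d. w \<notin> path_image p \<and> w \<notin> path_image c \<and> winding_number (p +++ c) w = i"
    using disk_closing[OF e(1) \<open>arc p\<close> pball, unfolded pends, OF tx(4) ty(4)]
    unfolding pends by metis
  have wn_pc: "winding_number (p +++ c) w = winding_number x2 w + winding_number y1 w + winding_number c w"
    if "w \<notin> path_image p" "w \<notin> path_image c" for w
    using that imp pp c ends unfolding p_def by (simp add: winding_number_join)
  \<comment> \<open>The collar occurs in \<open>p +++ c\<close> and in \<eta> with opposite
    directions, so it cancels when the winding numbers are added.\<close>
  define \<eta> where "\<eta> = y2 +++ (\<rho> +++ (x1 +++ reversepath c))"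
  have \<eta>: "path \<eta>" "pathfinish \<eta> = pathstart \<eta>"
    using pp \<rho> c ends pends by (auto simp: \<eta>_def)
  have im\<eta>: "path_image \<eta> = path_image y2 \<union> path_image \<rho> \<union> path_image x1 \<union> path_image c"
    using \<rho> c ends pends by (simp add: \<eta>_def path_image_join Un_assoc)
  have wn_\<eta>: "winding_number \<eta> w =
      winding_number y2 w + winding_number \<rho> w + winding_number x1 w - winding_number c w"
    if "w \<notin> path_image \<eta>" for w
  proof -
    have w: "w \<notin> path_image y2" "w \<notin> path_image \<rho>" "w \<notin> path_image x1" "w \<notin> path_image c"
      using that im\<eta> by auto
    show ?thesis
      unfolding \<eta>_def using w \<rho> c ends pends pp
      by (simp add: winding_number_join path_image_join winding_number_reversepath)
  qed
  have "v \<notin> path_image \<eta>"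
  proof -
    have "v \<notin> x ` {0..tx}"
    proof
      assume "v \<in> x ` {0..tx}"
      then obtain u where "u \<in> {0..tx}" "x u = x 1" using v by auto
      then have "u = 1" using tx by (intro inj_onD[OF inj(1)]) auto
      then show False using \<open>u \<in> {0..tx}\<close> tx by auto
    qed
    moreover have "v \<notin> y ` {ty..1}"
    proof
      assume "v \<in> y ` {ty..1}"
      then obtain u where "u \<in> {ty..1}" "y u = y 0" using v by auto
      then have "u = 0" using ty by (intro inj_onD[OF inj(2)]) auto
      then show False using \<open>u \<in> {ty..1}\<close> ty by auto
    qed
    moreover have "v \<notin> path_image c"
    proof
      assume "v \<in> path_image c"
      moreover have "v \<in> cball v e" using e by simp
      ultimately have "v \<in> {pathstart p, pathfinish p}" unfolding c(4)[symmetric] by (rule IntI)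
      then have "v = x tx \<or> v = y ty" using pends by simp
      then show False using tx(4) ty(4) e(1) by auto
    qed
    ultimately show ?thesis using im\<eta> imx imy \<rho> by auto
  qed
  then obtain d where d: "d > 0" "ball v d \<inter> path_image \<eta> = {}"
    using closed_path_image[OF \<eta>(1)] open_contains_ball[of "- path_image \<eta>"]
    by (metis ComplI disjoint_eq_subset_Compl open_Compl)
  define K where "K = winding_number \<eta> v"
  have split: "winding_number x w = winding_number x1 w + winding_number x2 w"
      "winding_number y w = winding_number y1 w + winding_number y2 w"
    if "w \<notin> path_image x" "w \<notin> path_image y" for w
    using winding_number_subpath_combine[of x w 0 tx 1] winding_number_subpath_combine[of y w 0 ty 1]
      that paths tx ty by (auto simp: x1_def x2_def y1_def y2_def)
  have xy_parts: "path_image x = path_image x1 \<union> path_image x2" "path_image y = path_image y1 \<union> path_image y2"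
  proof -
    have "{0..tx} \<union> {tx..1} = {0..1}" "{0..ty} \<union> {ty..1} = {0..1}"
      using tx ty by (simp_all add: ivl_disj_un_two_touch)
    then show "path_image x = path_image x1 \<union> path_image x2" "path_image y = path_image y1 \<union> path_image y2"
      unfolding imx imy by (simp_all add: path_image_def flip: image_Un)
  qed
  have off: "w \<notin> path_image x \<union> path_image y \<union> path_image \<rho>"
    if "w \<in> ball v d" "w \<notin> path_image p" for w
    using that d xy_parts imp im\<eta> by auto
  have W_K: "W w = winding_number (p +++ c) w + K" if "w \<in> ball v d" "w \<notin> path_image p" for w
  proof -
    have n: "w \<notin> path_image \<eta>" using that d by blast
    then have "w \<notin> path_image c" using im\<eta> by blast
    moreover have "winding_number \<eta> w = K" unfolding K_def
      using that d by (intro winding_number_eq[OF \<eta>, of _ "ball v d"]) auto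
    moreover have "w \<notin> path_image x" "w \<notin> path_image y" using off[OF that] by blast+
    ultimately show ?thesis
      unfolding W_def using split[of w] wn_\<eta>[OF n] wn_pc[OF that(2)] by (simp add: algebra_simps)
  qed
  have "K = 0"
  proof -
    have "v \<in> path_image p" using ends by (metis UnI1 imp pathfinish_in_path_image)
    then obtain w0 w1 where w: "w0 \<in> ball v d" "w0 \<notin> path_image p" "winding_number (p +++ c) w0 = 0"
      "w1 \<in> ball v d" "w1 \<notin> path_image p" "winding_number (p +++ c) w1 = 1"
      using wn_near[of v d 0] wn_near[of v d 1] d by blast
    then have "W w0 = K" "W w1 = 1 + K" using W_K by auto
    moreover have "W w0 \<in> {0, 1}" "W w1 \<in> {0, 1}" unfolding W_def using W01 off w by blast+
    ultimately show ?thesis by auto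
  qed
  \<comment> \<open>A parameter that lies before the first hit and whose point is in the ball where
    \<open>W_K\<close> applies.\<close>
  obtain s0 where s0: "0 < s0" "s0 < tg" "g s0 \<in> ball v d"
  proof -
    have "continuous_on {0..1} g" using paths by (simp add: path_def)
    then obtain b where b: "b > 0" "\<And>u. u \<in> {0..1} \<Longrightarrow> dist u 0 < b \<Longrightarrow> dist (g u) (g 0) < d"
      using d unfolding continuous_on_iff by (metis atLeastAtMost_iff order_refl zero_le_one)
    show thesis
      using b(2)[of "min (b / 2) (tg / 2)"] b(1) tg v
      by (intro that[of "min (b / 2) (tg / 2)"]) (auto simp: dist_commute dist_norm min_def split: if_splits)
  qed
  have loop: "path (x +++ (y +++ \<rho>))" "pathfinish (x +++ (y +++ \<rho>)) = pathstart (x +++ (y +++ \<rho>))"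
    and imloop: "path_image (x +++ (y +++ \<rho>)) = path_image x \<union> path_image y \<union> path_image \<rho>"
    using paths \<rho> x y by (auto simp: path_image_join)
  have W_loop: "W w = winding_number (x +++ (y +++ \<rho>)) w"
    if "w \<notin> path_image x \<union> path_image y \<union> path_image \<rho>" for w
    using that paths \<rho> x y by (simp add: W_def winding_number_join path_image_join)
  have "W (g s) = W (g s0)"
  proof -
    have "winding_number (x +++ (y +++ \<rho>)) (g s) = winding_number (x +++ (y +++ \<rho>)) (g s0)"
    proof (rule winding_number_eq[OF loop])
      show "topological_space_class.connected (g ` {0<..<1})"
        using paths by (intro connected_continuous_image) (auto simp: path_def intro: continuous_on_subset)
      show "g ` {0<..<1} \<inter> path_image (x +++ (y +++ \<rho>)) = {}"
        using g_off imloop by auto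
    qed (use s s0 tg in auto)
    then show ?thesis using W_loop g_off s s0 tg by simp
  qed
  have g_p: "g u \<notin> path_image p" if "0 < u" "u < 1" for u
    using g_off[OF that] imp sub(2,3) by blast
  note \<open>W (g s) = W (g s0)\<close>
  also have "W (g s0) = winding_number (p +++ c) (g s0)"
    using W_K[OF s0(3)] g_p[of s0] s0 tg \<open>K = 0\<close> by simp
  also have "\<dots> = winding_number (p +++ c) (g tg)"
  proof (rule winding_number_eq)
    show "path (p +++ c)" "pathfinish (p +++ c) = pathstart (p +++ c)"
      using c \<open>arc p\<close> by (auto intro: arc_imp_path)
    show "topological_space_class.connected (g ` {s0..tg})"
      using paths s0 tg by (intro connected_continuous_image) (auto simp: path_def intro: continuous_on_subset)
    have "g u \<notin> path_image (p +++ c)" if "u \<in> {s0..tg}" for u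
    proof -
      have u: "0 < u" "u < 1" using that s0 tg by auto
      have "g u \<notin> path_image p" using g_p[OF u] .
      moreover have "u \<in> {0..tg}" using that s0 by auto
      then have "g u \<in> cball v e" using tg(5) by blast
      moreover have "{pathstart p, pathfinish p} \<subseteq> path_image p" by auto
      ultimately have "g u \<notin> path_image c" using c(4) by blast
      then show ?thesis using \<open>g u \<notin> path_image p\<close> c by (simp add: path_image_join)
    qed
    then show "g ` {s0..tg} \<inter> path_image (p +++ c) = {}" by blast
  qed (use s0 tg in auto)
  also have "\<dots> = of_bool (ccw_points (y ty) (g tg) (x tx))"
    using wn_sphere[OF tg(4) g_p[OF tg(1,2)]] pends by simp
  finally show ?thesis unfolding W_def tx ty tg .
qed

text \<open>Below \<open>m\<close> the orientation of the first hits does not depend on the radius,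
  so "eventually" becomes a fixed truth value. Interchanging two of three distinct points of a
  circle reverses their orientation, whence the second claim.\<close>

lemma ccw_curves_iff_winding_number:
  assumes x: "arc x" "pathfinish x = v" and y: "arc y" "pathstart y = v"
    and xy: "path_image x \<inter> path_image y \<subseteq> {v}"
    and \<rho>: "path \<rho>" "pathstart \<rho> = pathfinish y" "pathfinish \<rho> = pathstart x" "v \<notin> path_image \<rho>"
    and W01: "\<And>w. w \<notin> path_image x \<union> path_image y \<union> path_image \<rho> \<Longrightarrow>
      winding_number x w + winding_number y w + winding_number \<rho> w \<in> {0, 1}"
    and g: "arc g" "pathstart g = v"
    and g_off: "\<And>s. 0 < s \<Longrightarrow> s < 1 \<Longrightarrow> g s \<notin> path_image x \<union> path_image y \<union> path_image \<rho>"
    and s: "0 < s" "s < 1"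
  shows "ccw_curves y g (reversepath x) \<longleftrightarrow>
      winding_number x (g s) + winding_number y (g s) + winding_number \<rho> (g s) = 1" (is ?A)
    and "ccw_curves g y (reversepath x) \<longleftrightarrow>
      winding_number x (g s) + winding_number y (g s) + winding_number \<rho> (g s) \<noteq> 1" (is ?B)
proof -
  define W where "W = winding_number x (g s) + winding_number y (g s) + winding_number \<rho> (g s)"
  define m where "m = min (dist v (pathstart x)) (min (dist v (pathfinish y)) (dist v (pathfinish g)))"
  have "m > 0" using x y g arc_distinct_ends by (fastforce simp: m_def)
  have ccw: "W = of_bool (ccw_points (first_hit y e) (first_hit g e) (first_hit (reversepath x) e))"
    "ccw_points (first_hit y e) (first_hit g e) (first_hit (reversepath x) e) \<longleftrightarrow>
      \<not> ccw_points (first_hit g e) (first_hit y e) (first_hit (reversepath x) e)"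
    if e: "e \<in> {0<..<m}" for e
  proof -
    have em: "0 < e" "e < dist v (pathstart x)" "e < dist v (pathfinish y)" "e < dist v (pathfinish g)"
      using e by (auto simp: m_def)
    show "W = of_bool (ccw_points (first_hit y e) (first_hit g e) (first_hit (reversepath x) e))"
      unfolding W_def by (rule ccw_first_hit_eq_winding_number[OF x y xy \<rho> W01 g g_off s em])
    have paths: "path (reversepath x)" "path y" "path g" using x y g by (auto intro: arc_imp_path)
    obtain a where a: "0 < a" "a < 1" "first_hit (reversepath x) e = reversepath x a" "reversepath x a \<in> sphere v e"
      using first_hit_obtain[of "reversepath x" v e] paths x em by auto
    obtain b where b: "0 < b" "b < 1" "first_hit y e = y b" "y b \<in> sphere v e"
      using first_hit_obtain[of y v e] paths y em by auto
    obtain c where c: "0 < c" "c < 1" "first_hit g e = g c" "g c \<in> sphere v e"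
      using first_hit_obtain[of g v e] paths g em by auto
    have ab: "reversepath x a \<in> path_image x" "y b \<in> path_image y"
      using a b by (auto simp: reversepath_def path_image_def)
    moreover have "reversepath x a \<noteq> v" using a em by auto
    ultimately have "reversepath x a \<noteq> y b" "g c \<noteq> y b" "g c \<noteq> reversepath x a"
      using xy g_off[OF c(1,2)] by auto
    then show "ccw_points (first_hit y e) (first_hit g e) (first_hit (reversepath x) e) \<longleftrightarrow>
      \<not> ccw_points (first_hit g e) (first_hit y e) (first_hit (reversepath x) e)"
      using ccw_points_sphere_cases[of "y b" v e "g c" "reversepath x a"] ccw_points_rotate em a b c by metis
  qed
  have ev: "\<forall>\<^sub>F e in at_right 0. e \<in> {0<..<m}" by (rule eventually_at_right_real[OF \<open>m > 0\<close>])
  have const: "(\<forall>\<^sub>F e in at_right 0. P e) \<longleftrightarrow> Q" if "\<And>e. e \<in> {0<..<m} \<Longrightarrow> P e \<longleftrightarrow> Q" for P :: "real \<Rightarrow> bool" and Q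
  proof -
    have "(\<forall>\<^sub>F e in at_right 0. P e) \<longleftrightarrow> (\<forall>\<^sub>F e in at_right (0::real). Q)"
      using ev by (intro eventually_cong) (use that in \<open>auto elim: eventually_mono\<close>)
    then show ?thesis by (simp add: trivial_limit_at_right_real)
  qed
  show ?A unfolding ccw_curves_def W_def[symmetric] by (rule const) (use ccw in auto)
  show ?B unfolding ccw_curves_def W_def[symmetric] by (rule const) (use ccw in auto)
qed


section \<open>Chains of curves\<close>

text \<open>The value at \<open>[]\<close> is arbitrary. The clause for one element avoids a
  trailing constant curve, which would destroy injectivity.\<close>

fun join_list :: "(real \<Rightarrow> complex) list \<Rightarrow> real \<Rightarrow> complex" where
  "join_list [] = (\<lambda>_. 0)"
| "join_list [g] = g"
| "join_list (g # h # gs) = g +++ join_list (h # gs)"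

abbreviation chained :: "(real \<Rightarrow> complex) list \<Rightarrow> bool" where
  "chained \<equiv> successively (\<lambda>g h. pathfinish g = pathstart h)"

lemma join_list_ends:
  assumes "gs \<noteq> []" "chained gs"
  shows "pathstart (join_list gs) = pathstart (hd gs)" "pathfinish (join_list gs) = pathfinish (last gs)"
  using assms by (induction gs rule: join_list.induct) auto

lemma path_image_join_list:
  assumes "gs \<noteq> []" "chained gs"
  shows "path_image (join_list gs) = (\<Union>g\<in>set gs. path_image g)"
  using assms
proof (induction gs rule: join_list.induct)
  case (3 g h gs)
  then show ?case using join_list_ends[of "h # gs"] by (simp add: path_image_join)
qed auto

lemma path_join_list:
  assumes "gs \<noteq> []" "chained gs" "\<forall>g\<in>set gs. path g"
  shows "path (join_list gs)"
  using assms
proof (induction gs rule: join_list.induct)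
  case (3 g h gs)
  then show ?case using join_list_ends[of "h # gs"] by simp
qed auto

lemma winding_number_join_list:
  assumes "gs \<noteq> []" "chained gs" "\<forall>g\<in>set gs. path g" "\<forall>g\<in>set gs. w \<notin> path_image g"
  shows "winding_number (join_list gs) w = (\<Sum>g\<leftarrow>gs. winding_number g w)"
  using assms
proof (induction gs rule: join_list.induct)
  case (3 g h gs)
  moreover have "path (join_list (h # gs))" "w \<notin> path_image (join_list (h # gs))"
    "pathstart (join_list (h # gs)) = pathstart h"
    using 3 path_join_list[of "h # gs"] path_image_join_list[of "h # gs"] join_list_ends[of "h # gs"]
    by auto
  ultimately show ?case by (simp add: winding_number_join)
qed auto


section \<open>Acyclic planar networks\<close>

locale acyclic_planar_network = perfect_planar_network +
  assumes acyclic: "acyclic_network G"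
begin

lemma closed_walk_trivial:
  assumes "awalk u p u" shows "p = []"
proof (rule ccontr)
  assume "p \<noteq> []"
  with assms have "closed_w p" by (auto simp: closed_w_def)
  then show False using closed_w_imp_cycle acyclic by (auto simp: acyclic_network_def)
qed

lemma awalk_distinct_verts:
  assumes "awalk u p v" shows "distinct (awalk_verts u p)"
  using awalk_not_distinct_decomp[OF assms] closed_walk_trivial by fastforce

text \<open>Reduces the finiteness of the set of walks to that of the set of simple paths.\<close>

lemma awalk_iff_apath: "awalk u p v \<longleftrightarrow> apath u p v"
  using awalk_distinct_verts by (auto simp: apath_def)

lemma tail_neq_head:
  assumes "e \<in> arcs G" shows "tail G e \<noteq> head G e"
  using arc_implies_awalk[OF assms] closed_walk_trivial by force

section \<open>Edges as curves in the disk\<close>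

lemma pos_inj: "u \<in> verts G \<Longrightarrow> v \<in> verts G \<Longrightarrow> pos u = pos v \<longleftrightarrow> u = v"
  using embedded by (auto simp: embedded_in_disk_def inj_on_def)

lemma crv_ends:
  assumes "e \<in> arcs G"
  shows "pathstart (crv e) = pos (tail G e)" "pathfinish (crv e) = pos (head G e)"
  using assms embedded by (auto simp: embedded_in_disk_def)

lemma arc_crv:
  assumes "e \<in> arcs G" shows "Path_Connected.arc (crv e)"
proof (rule simple_path_imp_arc)
  show "simple_path (crv e)" using assms embedded by (auto simp: embedded_in_disk_def)
  show "pathfinish (crv e) \<noteq> pathstart (crv e)"
    using assms tail_neq_head[OF assms, symmetric] by (simp add: crv_ends pos_inj)
qed

lemma crv_in_disk: "e \<in> arcs G \<Longrightarrow> path_image (crv e) \<subseteq> cball 0 1"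
  using embedded by (auto simp: embedded_in_disk_def)

lemma path_image_crv:
  assumes "e \<in> arcs G"
  shows "path_image (crv e) = crv e ` {0<..<1} \<union> {pos (tail G e), pos (head G e)}"
proof -
  have "{0..1::real} = insert 0 (insert 1 {0<..<1})" by auto
  then show ?thesis
    using crv_ends[OF assms] by (auto simp: path_image_def pathstart_def pathfinish_def)
qed

lemma crv_interior:
  assumes "e \<in> arcs G" "0 < s" "s < 1"
  shows "v \<in> verts G \<Longrightarrow> crv e s \<noteq> pos v"
    and "f \<in> arcs G \<Longrightarrow> f \<noteq> e \<Longrightarrow> crv e s \<notin> path_image (crv f)"
proof -
  have no: "crv e' ` {0<..<1} \<inter> pos ` verts G = {}" if "e' \<in> arcs G" for e'
    using that embedded by (auto simp: embedded_in_disk_def)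
  show 1: "crv e s \<noteq> pos v" if "v \<in> verts G" for v
  proof -
    have "crv e s \<in> crv e ` {0<..<1}" "pos v \<in> pos ` verts G" using assms that by auto
    then show ?thesis using no[OF assms(1)] by (metis disjoint_iff)
  qed
  assume f: "f \<in> arcs G" "f \<noteq> e"
  have "crv e ` {0<..<1} \<inter> crv f ` {0<..<1} = {}"
    using embedded f assms(1) by (auto simp: embedded_in_disk_def disjoint_family_on_def)
  moreover have "crv e s \<in> crv e ` {0<..<1}" using assms by auto
  ultimately have "crv e s \<notin> crv f ` {0<..<1}" by blast
  then show "crv e s \<notin> path_image (crv f)"
    using 1[of "tail G f"] 1[of "head G f"] f by (simp add: path_image_crv)
qed

lemma pos_in_crv:
  assumes "v \<in> verts G" "e \<in> arcs G" "pos v \<in> path_image (crv e)"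
  shows "v = tail G e \<or> v = head G e"
proof -
  have "pos v \<notin> crv e ` {0<..<1}"
    using crv_interior(1)[OF assms(2) _ _ assms(1)] by fastforce
  then have "pos v = pos (tail G e) \<or> pos v = pos (head G e)"
    using assms(2,3) by (simp add: path_image_crv)
  then show ?thesis using assms by (simp add: pos_inj)
qed

lemma crv_inter:
  assumes "e \<in> arcs G" "f \<in> arcs G" "e \<noteq> f" "z \<in> path_image (crv e)" "z \<in> path_image (crv f)"
  obtains u where "z = pos u" "u \<in> {tail G e, head G e}" "u \<in> {tail G f, head G f}"
proof -
  have "z \<notin> crv e ` {0<..<1}"
    using crv_interior(2)[OF assms(1) _ _ assms(2)] assms(3,5) by fastforce
  then have "z = pos (tail G e) \<or> z = pos (head G e)"
    using assms(1,4) by (simp add: path_image_crv)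
  then obtain u where u: "z = pos u" "u \<in> {tail G e, head G e}" by blast
  then have "u \<in> verts G" using assms(1) by auto
  then have "u = tail G f \<or> u = head G f" using pos_in_crv assms(2,5) u(1) by blast
  then show thesis using that u by blast
qed

section \<open>Walks as curves in the disk\<close>

definition walk_image :: "'b list \<Rightarrow> complex set" where
  "walk_image P = (\<Union>e\<in>set P. path_image (crv e))"

lemma chained_walk:
  assumes "awalk u P v" shows "chained (map crv P)"
  using assms
proof (induction P arbitrary: u)
  case (Cons e P)
  then show ?case
    by (cases P) (auto simp: awalk_Cons_iff crv_ends)
qed auto

lemma walk_ends:
  assumes "awalk u P v" "P \<noteq> []"
  shows "pathstart (crv (hd P)) = pos u" "pathfinish (crv (last P)) = pos v"
    "pathstart (join_list (map crv P)) = pos u" "pathfinish (join_list (map crv P)) = pos v"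
proof -
  have "set P \<subseteq> arcs G" using assms by auto
  then have a: "hd P \<in> arcs G" "last P \<in> arcs G" using assms by auto
  have "tail G (hd P) = u" using assms by (cases P) (auto simp: awalk_Cons_iff)
  moreover have "head G (last P) = v"
    using awlast_of_awalk[OF assms(1)] assms(2) by (auto simp: awalk_verts_conv)
  ultimately show *: "pathstart (crv (hd P)) = pos u" "pathfinish (crv (last P)) = pos v"
    using a by (simp_all add: crv_ends)
  then show "pathstart (join_list (map crv P)) = pos u" "pathfinish (join_list (map crv P)) = pos v"
    using join_list_ends[of "map crv P"] chained_walk[OF assms(1)] assms(2)
    by (simp_all add: hd_map last_map)
qed

lemma path_image_walk:
  assumes "awalk u P v" "P \<noteq> []"
  shows "path_image (join_list (map crv P)) = walk_image P"
  using path_image_join_list[of "map crv P"] chained_walk[OF assms(1)] assms(2) by (simp add: walk_image_def)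

text \<open>The curves of different arcs meet only at common end vertices and a walk has distinct
  vertices, so the first arc touches the rest of the walk only at its own head.\<close>

lemma arc_walk:
  assumes "awalk u P v" "P \<noteq> []"
  shows "Path_Connected.arc (join_list (map crv P))"
  using assms
proof (induction P arbitrary: u)
  case (Cons e P)
  show ?case
  proof (cases "P = []")
    case True
    then show ?thesis using Cons by (auto simp: awalk_Cons_iff arc_crv)
  next
    case False
    then obtain f P' where P: "P = f # P'" by (cases P) auto
    have e: "e \<in> arcs G" "u = tail G e" and w: "awalk (head G e) P v"
      using Cons by (auto simp: awalk_Cons_iff)
    have dist: "tail G e \<notin> set (awalk_verts (head G e) P)"
      using awalk_distinct_verts[OF Cons.prems(1)] by simp
    have "Path_Connected.arc (crv e +++ join_list (map crv P))"
    proof (rule arc_join[OF arc_crv[OF e(1)] Cons.IH[OF w False]])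
      show "pathfinish (crv e) = pathstart (join_list (map crv P))"
        using walk_ends[OF w False] e by (simp add: crv_ends)
      show "path_image (crv e) \<inter> path_image (join_list (map crv P)) \<subseteq> {pathstart (join_list (map crv P))}"
      proof
        fix z assume "z \<in> path_image (crv e) \<inter> path_image (join_list (map crv P))"
        then obtain h where h: "h \<in> set P" "z \<in> path_image (crv e)" "z \<in> path_image (crv h)"
          unfolding path_image_walk[OF w False] by (auto simp: walk_image_def)
        have hv: "{tail G h, head G h} \<subseteq> set (awalk_verts (head G e) P)"
          using awalk_verts_arc1 awalk_verts_arc2[OF w] h by auto
        have "h \<in> arcs G" "h \<noteq> e" using w h hv dist by auto
        then obtain x where x: "z = pos x" "x \<in> {tail G e, head G e}" "x \<in> {tail G h, head G h}"
          using crv_inter[OF e(1)] h by metis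
        then have "x = head G e" using hv dist by auto
        then show "z \<in> {pathstart (join_list (map crv P))}"
          using x walk_ends[OF w False] by simp
      qed
    qed
    then show ?thesis by (simp add: P)
  qed
qed simp

text \<open>Distinctness of the vertices keeps the passed vertex \<open>head G x\<close> away from
  both remaining pieces and from the ends of the walk, as the local comparison at this vertex
  requires.\<close>

lemma awalk_split:
  assumes "awalk u (P1 @ x # y # P2) v"
  shows "awalk u P1 (tail G x)" "x \<in> arcs G" "y \<in> arcs G" "tail G y = head G x" "awalk (head G y) P2 v"
    "head G x \<notin> set (awalk_verts u P1)" "head G x \<notin> set (awalk_verts (head G y) P2)"
    "head G x \<noteq> u" "head G x \<noteq> v"
proof -
  have a: "awalk u P1 (awlast u P1)" "awalk (awlast u P1) (x # y # P2) v"
    using assms by (simp_all only: awalk_append_iff)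
  have t: "awlast u P1 = tail G x" using a(2) by (simp only: awalk_Cons_iff)
  show "awalk u P1 (tail G x)" using a(1) unfolding t .
  show x: "x \<in> arcs G" and y: "y \<in> arcs G" and xy: "tail G y = head G x"
    and w: "awalk (head G y) P2 v"
    using a(2) by (simp_all only: awalk_Cons_iff)
  have "awalk_verts u (P1 @ x # y # P2) = awalk_verts u P1 @ tl (awalk_verts (awlast u P1) (x # y # P2))"
    by (rule awalk_verts_append[OF assms])
  also have "tl (awalk_verts (awlast u P1) (x # y # P2)) = head G x # awalk_verts (head G y) P2"
    by (simp only: awalk_verts.simps list.sel xy)
  finally have d: "distinct (awalk_verts u P1 @ head G x # awalk_verts (head G y) P2)"
    using awalk_distinct_verts[OF assms] by (simp only:)
  then show 1: "head G x \<notin> set (awalk_verts u P1)" "head G x \<notin> set (awalk_verts (head G y) P2)"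
    by simp_all
  show "head G x \<noteq> u" using 1(1) hd_in_awalk_verts(1)[OF a(1)] by blast
  have "awlast (head G y) P2 = v" using w by (simp only: awalk_conv)
  then show "head G x \<noteq> v" using 1(2) last_in_set[OF awalk_verts_non_Nil, of "head G y" P2] by metis
qed

text \<open>\<open>S\<close> is the left side of \<open>P\<close>, where the closed-up walk has
  winding number 1. These three properties are all that is used of winding numbers
  afterwards.\<close>

lemma walk_side:
  assumes P: "awalk u P v" "P \<noteq> []" and bd: "pos u \<in> sphere 0 1" "pos v \<in> sphere 0 1"
  obtains S :: "complex \<Rightarrow> bool" where
    "\<And>C z w. \<lbrakk>topological_space_class.connected C; C \<subseteq> cball 0 1; C \<inter> walk_image P = {}; z \<in> C; w \<in> C\<rbrakk> \<Longrightarrow> S z \<longleftrightarrow> S w"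
    "\<And>c. \<lbrakk>c \<in> sphere 0 1; c \<notin> walk_image P\<rbrakk> \<Longrightarrow> S c \<longleftrightarrow> ccw_points (pos v) c (pos u)"
    "\<And>P1 x y P2 g s. \<lbrakk>P = P1 @ x # y # P2; Path_Connected.arc g; pathstart g = pos (head G x);
        \<And>s. 0 < s \<Longrightarrow> s < 1 \<Longrightarrow> g s \<in> cball 0 1 - walk_image P; 0 < s; s < 1\<rbrakk> \<Longrightarrow>
        (ccw_curves (crv y) g (reversepath (crv x)) \<longleftrightarrow> S (g s)) \<and>
        (ccw_curves g (crv y) (reversepath (crv x)) \<longleftrightarrow> \<not> S (g s))"
proof -
  define p where "p = join_list (map crv P)"
  have arcs: "set P \<subseteq> arcs G" using P by auto
  have imp: "path_image p = walk_image P" unfolding p_def by (rule path_image_walk[OF P])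
  have ends: "pathstart p = pos u" "pathfinish p = pos v" unfolding p_def using walk_ends[OF P] by auto
  have sub: "path_image p \<subseteq> cball 0 1" unfolding imp walk_image_def using arcs crv_in_disk by blast
  have arcp: "Path_Connected.arc p" unfolding p_def by (rule arc_walk[OF P])
  obtain c where c: "path c" "pathstart c = pathfinish p" "pathfinish c = pathstart p"
    "path_image c \<inter> cball 0 1 = {pathstart p, pathfinish p}"
    and wn01: "\<And>w. w \<notin> path_image p \<Longrightarrow> w \<notin> path_image c \<Longrightarrow> winding_number (p +++ c) w \<in> {0, 1}"
    and wn_sphere: "\<And>w. w \<in> sphere 0 1 \<Longrightarrow> w \<notin> path_image p \<Longrightarrow>
        winding_number (p +++ c) w = of_bool (ccw_points (pathfinish p) w (pathstart p))"
    using disk_closing[OF zero_less_one arcp sub, unfolded ends, OF bd] unfolding ends by metis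
  have pathp: "path p" using arcp by (rule arc_imp_path)
  have loop: "path (p +++ c)" "pathfinish (p +++ c) = pathstart (p +++ c)"
    and iml: "path_image (p +++ c) = path_image p \<union> path_image c"
    using pathp c by (auto simp: path_image_join)
  have cdisk: "z \<notin> path_image c" if "z \<in> cball 0 1" "z \<notin> walk_image P" for z
  proof
    assume "z \<in> path_image c"
    then have "z \<in> {pathstart p, pathfinish p}" unfolding c(4)[symmetric] using that by blast
    then show False using that(2) imp by auto
  qed
  define S where "S z \<longleftrightarrow> winding_number (p +++ c) z = 1" for z
  have chain: "chained (map crv P)" by (rule chained_walk[OF P(1)])
  show thesis
  proof (rule that[of S])
    fix C z w assume C: "topological_space_class.connected C" "C \<subseteq> cball 0 1" "C \<inter> walk_image P = {}" "z \<in> C" "w \<in> C"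
    have "C \<inter> path_image (p +++ c) = {}" using C cdisk iml imp by blast
    then have "winding_number (p +++ c) z = winding_number (p +++ c) w"
      using C winding_number_eq[OF loop] by metis
    then show "S z \<longleftrightarrow> S w" by (simp add: S_def)
  next
    fix z :: complex assume "z \<in> sphere 0 1" "z \<notin> walk_image P"
    then show "S z \<longleftrightarrow> ccw_points (pos v) z (pos u)"
      using wn_sphere[of z] ends imp by (auto simp: S_def)
  next
    fix P1 x y P2 g s
    assume dec: "P = P1 @ x # y # P2" and g: "Path_Connected.arc g" "pathstart g = pos (head G x)"
      and g_off: "\<And>s. 0 < s \<Longrightarrow> s < 1 \<Longrightarrow> g s \<in> cball 0 1 - walk_image P" and s: "0 < s" "s < (1::real)"
    note sp = awalk_split[OF P(1)[unfolded dec]]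
    \<comment> \<open>The rest of the closed curve in the order in which it is traversed: from the
      head of \<open>y\<close> along \<open>P2\<close>, around by \<open>c\<close>, and along
      \<open>P1\<close> to the tail of \<open>x\<close>. If \<open>P1\<close> or \<open>P2\<close>
      is empty, an end of \<open>c\<close> takes its place.\<close>
    define L where "L = map crv P2 @ [c] @ map crv P1"
    define \<rho> where "\<rho> = join_list L"
    have arcs12: "set P1 \<subseteq> arcs G" "set P2 \<subseteq> arcs G" using arcs dec by auto
    have hv: "head G x \<in> verts G" "tail G x \<in> verts G" "head G y \<in> verts G" using sp by auto
    have "chained (map crv P1)" "chained (map crv P2)" using chained_walk sp by blast+
    moreover have "P2 = [] \<or> pathfinish (last (map crv P2)) = pathstart c"
      using walk_ends(2)[OF sp(5)] c ends by (metis last_map)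
    moreover have "P1 = [] \<or> pathfinish c = pathstart (hd (map crv P1))"
      using walk_ends(1)[OF sp(1)] c ends by (metis hd_map)
    ultimately have L: "chained L" "L \<noteq> []"
      unfolding L_def by (auto simp: successively_append_iff successively_Cons)
    have Lp: "\<forall>h\<in>set L. path h"
      unfolding L_def using c arcs12 arc_crv by (auto intro!: arc_imp_path)
    have imr: "path_image \<rho> = walk_image P1 \<union> walk_image P2 \<union> path_image c"
      unfolding \<rho>_def path_image_join_list[OF L(2,1)] by (auto simp: L_def walk_image_def)
    have startL: "pathstart (hd L) = pos (head G y)"
    proof (cases "P2 = []")
      case True
      then have "v = head G y" using sp(5) by (auto simp: awalk_Nil_iff)
      then show ?thesis using True c ends by (simp add: L_def)
    next
      case False
      then show ?thesis using walk_ends[OF sp(5)] by (simp add: L_def hd_append hd_map)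
    qed
    have finL: "pathfinish (last L) = pos (tail G x)"
    proof (cases "P1 = []")
      case True
      then have "u = tail G x" using sp(1) by (auto simp: awalk_Nil_iff)
      then show ?thesis using True c ends by (simp add: L_def)
    next
      case False
      then show ?thesis using walk_ends[OF sp(1)] by (simp add: L_def last_map)
    qed
    have wimg: "walk_image P = path_image (crv x) \<union> path_image (crv y) \<union> walk_image P1 \<union> walk_image P2"
      unfolding dec walk_image_def by auto
    have wn: "winding_number (p +++ c) w =
        winding_number (crv x) w + winding_number (crv y) w + winding_number \<rho> w"
      if "w \<notin> walk_image P" "w \<notin> path_image c" for w
    proof -
      have w: "\<forall>e\<in>set P. w \<notin> path_image (crv e)" using that(1) by (auto simp: walk_image_def)
      have "winding_number (p +++ c) w = winding_number p w + winding_number c w"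
        using that pathp c imp by (intro winding_number_join) auto
      moreover have "winding_number p w = (\<Sum>g\<leftarrow>map crv P. winding_number g w)"
        unfolding p_def
      proof (rule winding_number_join_list[OF _ chain])
        show "map crv P \<noteq> []" using P by simp
        show "\<forall>h\<in>set (map crv P). path h" using arcs arc_crv by (auto intro!: arc_imp_path)
        show "\<forall>h\<in>set (map crv P). w \<notin> path_image h" using w by simp
      qed
      moreover have "winding_number \<rho> w = (\<Sum>g\<leftarrow>L. winding_number g w)"
        unfolding \<rho>_def
      proof (rule winding_number_join_list[OF L(2,1) Lp])
        show "\<forall>h\<in>set L. w \<notin> path_image h" using w that(2) by (auto simp: L_def dec)
      qed
      ultimately show ?thesis by (simp add: dec L_def)
    qed
    have S: "S (g s) \<longleftrightarrow> winding_number (crv x) (g s) + winding_number (crv y) (g s) + winding_number \<rho> (g s) = 1"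
    proof -
      have "g s \<in> cball 0 1" "g s \<notin> walk_image P" using g_off[OF s] by blast+
      moreover from this have "g s \<notin> path_image c" by (rule cdisk)
      ultimately show ?thesis using wn by (simp add: S_def)
    qed
    have conds: "pathfinish (crv x) = pos (head G x)" "pathstart (crv y) = pos (head G x)"
        "path_image (crv x) \<inter> path_image (crv y) \<subseteq> {pos (head G x)}"
        "path \<rho>" "pathstart \<rho> = pathfinish (crv y)" "pathfinish \<rho> = pathstart (crv x)"
        "pos (head G x) \<notin> path_image \<rho>"
    proof -
      show "pathfinish (crv x) = pos (head G x)" "pathstart (crv y) = pos (head G x)"
        using sp by (simp_all add: crv_ends)
      show "path \<rho>" unfolding \<rho>_def by (rule path_join_list[OF L(2,1) Lp])
      show "pathstart \<rho> = pathfinish (crv y)" "pathfinish \<rho> = pathstart (crv x)"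
        unfolding \<rho>_def join_list_ends[OF L(2,1)] startL finL using sp by (simp_all add: crv_ends)
      have "tail G x \<noteq> head G y"
        using closed_walk_trivial[of "tail G x" "[x, y]"] sp hv by (auto simp: awalk_simps)
      have "x \<noteq> y" using sp(3,4) tail_neq_head by metis
      show "path_image (crv x) \<inter> path_image (crv y) \<subseteq> {pos (head G x)}"
      proof
        fix z assume "z \<in> path_image (crv x) \<inter> path_image (crv y)"
        then obtain u' where "z = pos u'" "u' \<in> {tail G x, head G x}" "u' \<in> {tail G y, head G y}"
          using crv_inter[OF sp(2,3) \<open>x \<noteq> y\<close>] by blast
        then show "z \<in> {pos (head G x)}"
          using \<open>tail G x \<noteq> head G y\<close> tail_neq_head[OF sp(2)] sp(4) by auto
      qed
      have "pos (head G x) \<notin> path_image (crv e)" if "e \<in> set P1 \<union> set P2" for e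
      proof
        assume "pos (head G x) \<in> path_image (crv e)"
        then have "head G x \<in> {tail G e, head G e}"
          using pos_in_crv[OF hv(1)] arcs12 that by blast
        then have "head G x \<in> set (awalk_verts u P1) \<union> set (awalk_verts (head G y) P2)"
          using that awalk_verts_arc1[of e P1 u] awalk_verts_arc1[of e P2 "head G y"]
            awalk_verts_arc2[OF sp(1)] awalk_verts_arc2[OF sp(5)] by auto
        then show False using sp(6,7) by blast
      qed
      moreover have "pos (head G x) \<notin> path_image c"
      proof
        assume a: "pos (head G x) \<in> path_image c"
        have "pos (head G x) \<in> cball 0 1"
          using crv_in_disk[OF sp(2)] crv_ends[OF sp(2)] by (metis pathfinish_in_path_image subsetD)
        with a have "pos (head G x) \<in> {pos u, pos v}"
          unfolding ends[symmetric] c(4)[symmetric] by (rule IntI)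
        moreover have "u \<in> verts G" "v \<in> verts G" using P(1) by auto
        ultimately show False using sp(8,9) hv by (auto simp: pos_inj)
      qed
      ultimately show "pos (head G x) \<notin> path_image \<rho>"
        unfolding imr walk_image_def by blast
    qed
    have w01: "winding_number (crv x) w + winding_number (crv y) w + winding_number \<rho> w \<in> {0, 1}"
      if "w \<notin> path_image (crv x) \<union> path_image (crv y) \<union> path_image \<rho>" for w
    proof -
      have "w \<notin> walk_image P" "w \<notin> path_image c" using that unfolding wimg imr by blast+
      then show ?thesis using wn01[of w] wn[of w] unfolding imp by simp
    qed
    have off: "g s \<notin> path_image (crv x) \<union> path_image (crv y) \<union> path_image \<rho>" if "0 < s" "s < 1" for s
    proof -
      have "g s \<in> cball 0 1" "g s \<notin> walk_image P" using g_off[OF that] by blast+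
      moreover from this have "g s \<notin> path_image c" by (rule cdisk)
      ultimately show ?thesis unfolding imr wimg by blast
    qed
    note ccw = ccw_curves_iff_winding_number[OF arc_crv[OF sp(2)] conds(1) arc_crv[OF sp(3)] conds(2-7) w01 g off s]
    show "(ccw_curves (crv y) g (reversepath (crv x)) \<longleftrightarrow> S (g s)) \<and>
        (ccw_curves g (crv y) (reversepath (crv x)) \<longleftrightarrow> \<not> S (g s))"
      unfolding S by (rule conjI[OF ccw])
  qed
qed

end

section \<open>Local weights\<close>

text \<open>\<open>white_turn\<close> and \<open>black_turn\<close> are the conditions of
  \<open>white_contrib\<close> and \<open>black_contrib\<close>, detached from the tensors so that
  the weights become scalars.\<close>

definition white_turn ::
    "('v, 'e) pre_digraph \<Rightarrow> ('v \<Rightarrow> complex) \<Rightarrow> ('e \<Rightarrow> real \<Rightarrow> complex) \<Rightarrow> 'v \<Rightarrow> 'e \<Rightarrow> 'e \<Rightarrow> bool" where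
  "white_turn G pos crv v x1 x2 \<longleftrightarrow>
     white G pos v \<and> x1 \<in> out_arcs G v \<and> x2 \<in> out_arcs G v \<and> x1 \<noteq> x2 \<and>
     (\<exists>x3\<in>in_arcs G v. ccw_curves (crv x1) (crv x2) (reversepath (crv x3)))"

definition black_turn ::
    "('v, 'e) pre_digraph \<Rightarrow> ('v \<Rightarrow> complex) \<Rightarrow> ('e \<Rightarrow> real \<Rightarrow> complex) \<Rightarrow> 'v \<Rightarrow> 'e \<Rightarrow> 'e \<Rightarrow> bool" where
  "black_turn G pos crv v y1 y2 \<longleftrightarrow>
     black G pos v \<and> y1 \<in> in_arcs G v \<and> y2 \<in> in_arcs G v \<and> y1 \<noteq> y2 \<and>
     (\<exists>y3\<in>out_arcs G v. ccw_curves (reversepath (crv y1)) (reversepath (crv y2)) (crv y3))"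

text \<open>
  The bracket of the edges \<open>e\<close>, \<open>f\<close> is \<open>tail_weight e f (e \<otimes> f) + head_weight e f (f \<otimes> e)\<close>; the first
  part comes from a common tail, the second from a common head.
\<close>

definition tail_weight ::
    "('v, 'e) pre_digraph \<Rightarrow> ('v \<Rightarrow> complex) \<Rightarrow> ('e \<Rightarrow> real \<Rightarrow> complex) \<Rightarrow> 'e \<Rightarrow> 'e \<Rightarrow> 'k::field_char_0" where
  "tail_weight G pos crv e f =
     (\<Sum>v\<in>internal_verts G pos.
        (of_bool (white_turn G pos crv v e f) - of_bool (white_turn G pos crv v f e)) / 2)"

definition head_weight ::
    "('v, 'e) pre_digraph \<Rightarrow> ('v \<Rightarrow> complex) \<Rightarrow> ('e \<Rightarrow> real \<Rightarrow> complex) \<Rightarrow> 'e \<Rightarrow> 'e \<Rightarrow> 'k::field_char_0" where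
  "head_weight G pos crv e f =
     (\<Sum>v\<in>internal_verts G pos.
        (of_bool (black_turn G pos crv v f e) - of_bool (black_turn G pos crv v e f)) / 2)"

lemma tail_weight_zero: "tail G e \<noteq> tail G f \<or> e = f \<Longrightarrow> tail_weight G pos crv e f = 0"
  by (auto simp: tail_weight_def white_turn_def intro!: sum.neutral)

lemma head_weight_zero: "head G e \<noteq> head G f \<or> e = f \<Longrightarrow> head_weight G pos crv e f = 0"
  by (auto simp: head_weight_def black_turn_def intro!: sum.neutral)

lemma ccw_curves_rotate: "ccw_curves a b c \<longleftrightarrow> ccw_curves b c a"
  by (simp add: ccw_curves_def ccw_points_rotate[symmetric])

context acyclic_planar_network
begin

abbreviation "tw \<equiv> tail_weight G pos crv"
abbreviation "hw \<equiv> head_weight G pos crv"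

lemma tail_weight_eq:
  assumes "tail G f = v" "v \<in> internal_verts G pos"
  shows "tw e f = (of_bool (white_turn G pos crv v e f) - of_bool (white_turn G pos crv v f e)) / 2"
proof -
  have "tw e f = (\<Sum>u\<in>{v}. (of_bool (white_turn G pos crv u e f) - of_bool (white_turn G pos crv u f e)) / 2)"
    unfolding tail_weight_def using assms
    by (intro sum.mono_neutral_right) (auto simp: internal_verts_def white_turn_def)
  then show ?thesis by simp
qed

lemma head_weight_eq:
  assumes "head G f = v" "v \<in> internal_verts G pos"
  shows "hw f e = (of_bool (black_turn G pos crv v e f) - of_bool (black_turn G pos crv v f e)) / 2"
proof -
  have "hw f e = (\<Sum>u\<in>{v}. (of_bool (black_turn G pos crv u e f) - of_bool (black_turn G pos crv u f e)) / 2)"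
    unfolding head_weight_def using assms
    by (intro sum.mono_neutral_right) (auto simp: internal_verts_def black_turn_def)
  then show ?thesis by simp
qed

text \<open>There are no loops, so no arc is counted twice.\<close>

lemma card_incident: "card (in_arcs G v \<union> out_arcs G v) = in_degree G v + out_degree G v"
proof -
  have "in_arcs G v \<inter> out_arcs G v = {}" using tail_neq_head by fastforce
  moreover have "finite (in_arcs G v)" "finite (out_arcs G v)"
    by (auto intro: finite_subset[OF _ finite_arcs])
  ultimately show ?thesis by (simp add: card_Un_disjoint in_degree_def out_degree_def)
qed

lemma boundary_one_arc:
  assumes "v \<in> boundary_verts G pos" "e \<in> in_arcs G v \<union> out_arcs G v" "f \<in> in_arcs G v \<union> out_arcs G v"
  shows "e = f"
proof -
  have "card (in_arcs G v \<union> out_arcs G v) = 1"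
    using boundary_univalent[OF assms(1)] card_incident by simp
  then show ?thesis using assms(2,3) by (metis card_1_singletonE singletonD)
qed

lemma internal_three_arcs:
  assumes "v \<in> internal_verts G pos" "{x, y, f} \<subseteq> in_arcs G v \<union> out_arcs G v" "distinct [x, y, f]"
  shows "in_arcs G v \<union> out_arcs G v = {x, y, f}"
proof -
  have "card (in_arcs G v \<union> out_arcs G v) = 3"
    using internal_trivalent[OF assms(1)] card_incident by simp
  then show ?thesis using assms(2,3)
    by (intro card_seteq[symmetric]) auto
qed

lemma walk_vertex_cases:
  assumes P: "awalk u P t" and v: "v \<in> set (awalk_verts u P)" "v \<noteq> u" "v \<noteq> t"
  obtains P1 x y P2 where "P = P1 @ x # y # P2" "head G x = v"
proof -
  obtain q r where qr: "P = q @ r" "awalk u q v" "awalk v r t"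
    using awalk_decomp[OF P v(1)] by blast
  have "q \<noteq> []" "r \<noteq> []" using qr v by (auto simp: awalk_Nil_iff)
  then obtain P1 x y P2 where "q = P1 @ [x]" "r = y # P2" by (metis neq_Nil_conv rev_exhaust)
  then show thesis using that[of P1 x y P2] qr by (auto simp: awalk_Cons_iff awalk_Nil_iff)
qed

text \<open>Passing through a vertex takes two different arcs there, but a boundary vertex has only
  one.\<close>

lemma walk_boundary_vertex:
  assumes P: "awalk u P t" and v: "v \<in> set (awalk_verts u P)" "v \<in> boundary_verts G pos"
  shows "v = u \<or> v = t"
proof (rule ccontr)
  assume "\<not> ?thesis"
  then obtain P1 x y P2 where d: "P = P1 @ x # y # P2" "head G x = v"
    using walk_vertex_cases[OF P v(1)] by blast
  note sp = awalk_split[OF P[unfolded d(1)]]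
  have "x = y" using boundary_one_arc[OF v(2), of x y] sp d by auto
  then show False using sp tail_neq_head by metis
qed

lemma walk_tail_inj:
  assumes "awalk u P t" "e \<in> set P" "f \<in> set P" "tail G e = tail G f"
  shows "e = f"
proof -
  have "P \<noteq> []" using assms by auto
  then have "distinct (map (tail G) P)"
    using awalk_distinct_verts[OF assms(1)] by (auto simp: awalk_verts_conv)
  then show ?thesis using assms by (auto simp: distinct_map inj_on_def)
qed

lemma walk_head_inj:
  assumes "awalk u P t" "e \<in> set P" "f \<in> set P" "head G e = head G f"
  shows "e = f"
proof -
  have "P \<noteq> []" "cas u P t" using assms by auto
  then have "distinct (map (head G) P)"
    using awalk_distinct_verts[OF assms(1)] by (auto simp: awalk_verts_conv')
  then show ?thesis using assms by (auto simp: distinct_map inj_on_def)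
qed

lemma walk_distinct: "awalk u P t \<Longrightarrow> distinct P"
  using distinct_verts_imp_distinct awalk_distinct_verts by blast

text \<open>The arc \<open>f\<close> off the walk comes in addition to an arc of the walk at the
  same vertex, so the vertex is not univalent.\<close>

lemma off_walk_internal:
  assumes P: "awalk u P t" "P \<noteq> []" and f: "f \<in> arcs G" "f \<notin> set P"
    and v: "v \<in> set (awalk_verts u P)" "v = tail G f \<or> v = head G f"
  shows "v \<in> internal_verts G pos"
proof (rule ccontr)
  assume "v \<notin> internal_verts G pos"
  then have b: "v \<in> boundary_verts G pos" using f v by (auto simp: internal_verts_def)
  obtain e where e: "e \<in> set P" "v = tail G e \<or> v = head G e"
    using v(1) set_awalk_verts_not_Nil[OF P] by auto
  have "e \<in> arcs G" using e P by auto
  then have "e = f" using boundary_one_arc[OF b] e f v by auto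
  then show False using e f by simp
qed

lemma vertex_off_walk:
  assumes "awalk u P t" "v \<in> verts G" "v \<notin> set (awalk_verts u P)"
  shows "pos v \<notin> walk_image P"
proof
  assume "pos v \<in> walk_image P"
  then obtain e where e: "e \<in> set P" "pos v \<in> path_image (crv e)" by (auto simp: walk_image_def)
  then have "e \<in> arcs G" using assms(1) by auto
  then have "v = tail G e \<or> v = head G e" using pos_in_crv[OF assms(2)] e by blast
  then show False using assms e awalk_verts_arc1[of e P u] awalk_verts_arc2[OF assms(1)] by auto
qed

text \<open>
  The potential \<open>w\<close> is \<open>1/2\<close> to the left of \<open>P\<close>, \<open>0\<close> on \<open>P\<close> and \<open>- 1/2\<close> to the right of \<open>P\<close>.
\<close>

lemma weight_step:
  fixes w :: "'a \<Rightarrow> 'k::field_char_0"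
  assumes P: "awalk u P t" "P \<noteq> []" and bd: "u \<in> boundary_verts G pos" "t \<in> boundary_verts G pos"
    and conn: "\<And>C z w. \<lbrakk>topological_space_class.connected C; C \<subseteq> cball 0 1; C \<inter> walk_image P = {}; z \<in> C; w \<in> C\<rbrakk> \<Longrightarrow> S z \<longleftrightarrow> S w"
    and loc: "\<And>P1 x y P2 g s. \<lbrakk>P = P1 @ x # y # P2; Path_Connected.arc g; pathstart g = pos (head G x);
        \<And>s. 0 < s \<Longrightarrow> s < 1 \<Longrightarrow> g s \<in> cball 0 1 - walk_image P; 0 < s; s < 1\<rbrakk> \<Longrightarrow>
        (ccw_curves (crv y) g (reversepath (crv x)) \<longleftrightarrow> S (g s)) \<and>
        (ccw_curves g (crv y) (reversepath (crv x)) \<longleftrightarrow> \<not> S (g s))"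
    and w: "\<And>v. w v = (if v \<in> set (awalk_verts u P) then 0 else of_bool (S (pos v)) - 1 / 2)"
    and f: "f \<in> arcs G"
  shows "(\<Sum>e\<in>set P. tw e f + hw f e) = w (head G f) - w (tail G f)"
proof (cases "f \<in> set P")
  case True
  \<comment> \<open>An edge common to both walks: no other edge of \<open>P\<close> shares its tail
    or its head, and an edge has weight 0 with itself. Both of its ends lie on \<open>P\<close>,
    where the potential vanishes.\<close>
  have "tw e f + hw f e = (0::'k)" if "e \<in> set P" for e
  proof -
    have "tail G e \<noteq> tail G f \<or> e = f" "head G f \<noteq> head G e \<or> f = e"
      using walk_tail_inj[OF P(1) that True] walk_head_inj[OF P(1) that True] by metis+
    then show ?thesis by (simp only: tail_weight_zero head_weight_zero add_0)
  qed
  then have "(\<Sum>e\<in>set P. tw e f + hw f e) = (0::'k)" by (intro sum.neutral) auto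
  moreover have "tail G f \<in> set (awalk_verts u P)" "head G f \<in> set (awalk_verts u P)"
    using True awalk_verts_arc1 awalk_verts_arc2[OF P(1)] by auto
  ultimately show ?thesis by (simp add: w)
next
  case False
  let ?V = "set (awalk_verts u P)"
  have arcsP: "set P \<subseteq> arcs G" using P by auto
  have off: "crv f s \<in> cball 0 1 - walk_image P" if "0 < s" "s < 1" for s
  proof -
    have "crv f s \<notin> path_image (crv e)" if "e \<in> set P" for e
      using crv_interior(2)[OF f \<open>0 < s\<close> \<open>s < 1\<close>, of e] arcsP that False by auto
    moreover have "crv f s \<in> path_image (crv f)" using that by (auto simp: path_image_def)
    ultimately show ?thesis using crv_in_disk[OF f] by (auto simp: walk_image_def)
  qed
  \<comment> \<open>The side of \<open>P\<close> on which the interior of \<open>f\<close> lies;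
    \<open>1 / 2\<close> is an arbitrary interior parameter. \<open>S_same\<close> extends this to
    those ends of \<open>f\<close> that are not on \<open>P\<close>.\<close>
  define b where "b = S (crv f (1 / 2))"
  have pathf: "path (crv f)" using arc_crv[OF f] by (rule arc_imp_path)
  note vert_off = vertex_off_walk[OF P(1)]
  have S_same: "S (crv f s) \<longleftrightarrow> b" if "s \<in> {0..1}" "crv f s \<notin> walk_image P" for s
    unfolding b_def
  proof (rule conn)
    show "topological_space_class.connected (crv f ` closed_segment s (1 / 2))"
      using that pathf
      by (intro connected_continuous_image)
         (auto simp: path_def closed_segment_eq_real_ivl intro: continuous_on_subset)
    have "crv f r \<in> cball 0 1 - walk_image P" if "r \<in> closed_segment s (1 / 2)" for r
    proof (cases "r = s")
      case True
      have "crv f s \<in> path_image (crv f)" using \<open>s \<in> {0..1}\<close> by (auto simp: path_image_def)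
      then show ?thesis using True \<open>crv f s \<notin> walk_image P\<close> crv_in_disk[OF f] by auto
    next
      case False
      then show ?thesis using that \<open>s \<in> {0..1}\<close>
        by (intro off) (auto simp: closed_segment_eq_real_ivl split: if_splits)
    qed
    then show "crv f ` closed_segment s (1 / 2) \<subseteq> cball 0 1"
      "crv f ` closed_segment s (1 / 2) \<inter> walk_image P = {}" by auto
  qed auto
  have ends: "crv f 0 = pos (tail G f)" "crv f 1 = pos (head G f)"
    using crv_ends[OF f] by (auto simp: pathstart_def pathfinish_def)
  have "(\<Sum>e\<in>set P. tw e f) = (if tail G f \<in> ?V then of_bool b - 1 / 2 else (0::'k))"
  proof (cases "tail G f \<in> ?V")
    case True
    then have int: "tail G f \<in> internal_verts G pos"
      using off_walk_internal[OF P f False] by blast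
    then have "tail G f \<noteq> u" "tail G f \<noteq> t" using bd by (auto simp: internal_verts_def)
    then obtain P1 x y P2 where d: "P = P1 @ x # y # P2" "head G x = tail G f"
      using walk_vertex_cases[OF P(1) True] by blast
    note sp = awalk_split[OF P(1)[unfolded d(1)]]
    have ne: "y \<noteq> f" "x \<noteq> f" "x \<noteq> y" using False d sp tail_neq_head[of x] by auto
    \<comment> \<open>\<open>P\<close> enters the vertex by \<open>x\<close> and leaves it by
      \<open>y\<close>. With \<open>f\<close> these are all three arcs, so the vertex is white, with
      \<open>x\<close> as its incoming edge.\<close>
    have inc: "in_arcs G (tail G f) \<union> out_arcs G (tail G f) = {x, y, f}"
      using internal_three_arcs[OF int, of x y f] ne sp d f by auto
    have ins: "in_arcs G (tail G f) = {x}"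
    proof -
      have "y \<notin> in_arcs G (tail G f)" "f \<notin> in_arcs G (tail G f)" "x \<in> in_arcs G (tail G f)"
        using sp d tail_neq_head[of y] tail_neq_head[of f] f by auto
      moreover have "in_arcs G (tail G f) \<subseteq> {x, y, f}" using inc by auto
      ultimately show ?thesis by blast
    qed
    have white: "white G pos (tail G f)" using int ins by (simp add: white_def in_degree_def)
    have "ccw_curves (crv y) (crv f) (reversepath (crv x)) \<longleftrightarrow> b"
      "ccw_curves (crv f) (crv y) (reversepath (crv x)) \<longleftrightarrow> \<not> b"
      using loc[OF d(1) arc_crv[OF f] _ off, of "1 / 2"] crv_ends[OF f] d(2) by (simp_all add: b_def)
    then have "white_turn G pos crv (tail G f) y f \<longleftrightarrow> b" "white_turn G pos crv (tail G f) f y \<longleftrightarrow> \<not> b"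
      using white ins ne sp d f by (auto simp: white_turn_def)
    then have "tw y f = of_bool b - (1 / 2 :: 'k)" by (simp add: tail_weight_eq[OF refl int])
    moreover have "tw e f = (0::'k)" if "e \<in> set P - {y}" for e
    proof (rule tail_weight_zero)
      have "tail G e \<noteq> tail G y" using walk_tail_inj[OF P(1), of e y] that d by auto
      then show "tail G e \<noteq> tail G f \<or> e = f" using sp d by simp
    qed
    then have "(\<Sum>e\<in>set P. tw e f) = (\<Sum>e\<in>{y}. tw e f :: 'k)"
      using d by (intro sum.mono_neutral_right) auto
    ultimately show ?thesis using True by simp
  next
    case tail: False
    have "tw e f = (0::'k)" if "e \<in> set P" for e
      using that tail awalk_verts_arc1[of e P u] by (intro tail_weight_zero) metis
    then have "(\<Sum>e\<in>set P. tw e f) = (0::'k)" by (intro sum.neutral) auto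
    then show ?thesis using tail by simp
  qed
  moreover have "(\<Sum>e\<in>set P. hw f e) = (if head G f \<in> ?V then 1 / 2 - of_bool b else (0::'k))"
  proof (cases "head G f \<in> ?V")
    case True
    then have int: "head G f \<in> internal_verts G pos"
      using off_walk_internal[OF P f False] by blast
    then have "head G f \<noteq> u" "head G f \<noteq> t" using bd by (auto simp: internal_verts_def)
    then obtain P1 x y P2 where d: "P = P1 @ x # y # P2" "head G x = head G f"
      using walk_vertex_cases[OF P(1) True] by blast
    note sp = awalk_split[OF P(1)[unfolded d(1)]]
    have ne: "y \<noteq> f" "x \<noteq> f" "x \<noteq> y" using False d sp tail_neq_head[of x] by auto
    have inc: "in_arcs G (head G f) \<union> out_arcs G (head G f) = {x, y, f}"
      using internal_three_arcs[OF int, of x y f] ne sp d f by auto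
    have outs: "out_arcs G (head G f) = {y}"
    proof -
      have "x \<notin> out_arcs G (head G f)" "f \<notin> out_arcs G (head G f)" "y \<in> out_arcs G (head G f)"
        using sp d tail_neq_head[of x] tail_neq_head[of f] f by auto
      moreover have "out_arcs G (head G f) \<subseteq> {x, y, f}" using inc by auto
      ultimately show ?thesis by blast
    qed
    have black: "black G pos (head G f)" using int outs by (simp add: black_def out_degree_def)
    \<comment> \<open>Here \<open>f\<close> arrives at the vertex, so its reverse is the curve that
      leaves it. The cyclic triple is then rotated so that the outgoing edge \<open>y\<close> comes
      last, as in \<open>black_turn\<close>.\<close>
    let ?g = "reversepath (crv f)"
    have "?g s \<in> cball 0 1 - walk_image P" if "0 < s" "s < 1" for s
      using off[of "1 - s"] that by (simp add: reversepath_def)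
    moreover have "Path_Connected.arc ?g" "pathstart ?g = pos (head G x)" "?g (1 / 2) = crv f (1 / 2)"
      using arc_crv[OF f] crv_ends[OF f] d(2) by (simp_all add: arc_reversepath) (simp add: reversepath_def)
    ultimately have "ccw_curves (crv y) ?g (reversepath (crv x)) \<longleftrightarrow> b"
      "ccw_curves ?g (crv y) (reversepath (crv x)) \<longleftrightarrow> \<not> b"
      using loc[OF d(1), of ?g "1 / 2"] unfolding b_def by (simp_all del: Diff_iff)
    then have "ccw_curves ?g (reversepath (crv x)) (crv y) \<longleftrightarrow> b"
      "ccw_curves (reversepath (crv x)) ?g (crv y) \<longleftrightarrow> \<not> b"
      using ccw_curves_rotate by metis+
    then have "black_turn G pos crv (head G f) f x \<longleftrightarrow> b" "black_turn G pos crv (head G f) x f \<longleftrightarrow> \<not> b"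
      using black outs ne sp d f by (auto simp: black_turn_def)
    then have "hw f x = (1 / 2 :: 'k) - of_bool b" by (simp add: head_weight_eq[OF refl int])
    moreover have "hw f e = (0::'k)" if "e \<in> set P - {x}" for e
    proof (rule head_weight_zero)
      have "head G e \<noteq> head G x" using walk_head_inj[OF P(1), of e x] that d by auto
      then show "head G f \<noteq> head G e \<or> f = e" using sp d by simp
    qed
    then have "(\<Sum>e\<in>set P. hw f e) = (\<Sum>e\<in>{x}. hw f e :: 'k)"
      using d by (intro sum.mono_neutral_right) auto
    ultimately show ?thesis using True by simp
  next
    case head: False
    have "hw f e = (0::'k)" if "e \<in> set P" for e
      using that head awalk_verts_arc2[OF P(1)] by (intro head_weight_zero) metis
    then have "(\<Sum>e\<in>set P. hw f e) = (0::'k)" by (intro sum.neutral) auto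
    then show ?thesis using head by simp
  qed
  moreover have "w (tail G f) = (if tail G f \<in> ?V then 0 else of_bool b - 1 / 2)"
    using S_same[of 0] vert_off[of "tail G f"] f by (simp add: w ends)
  moreover have "w (head G f) = (if head G f \<in> ?V then 0 else of_bool b - 1 / 2)"
    using S_same[of 1] vert_off[of "head G f"] f by (simp add: w ends)
  ultimately show ?thesis by (simp add: sum.distrib)
qed

lemma telescope_walk:
  fixes w :: "'a \<Rightarrow> 'k::ab_group_add"
  assumes "awalk u Q v"
  shows "(\<Sum>f\<leftarrow>Q. w (head G f) - w (tail G f)) = w v - w u"
  using assms by (induction Q arbitrary: u) (auto simp: awalk_simps)

lemma boundary_source_props:
  assumes "v \<in> boundary_sources G pos" "v' \<in> boundary_sinks G pos"
  shows "v \<in> boundary_verts G pos" "v' \<in> boundary_verts G pos" "v \<noteq> v'"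
  using assms boundary_univalent by (force simp: boundary_sources_def boundary_sinks_def)+

text \<open>Along \<open>Q\<close> the potential telescopes to its value at \<open>snk l\<close>
  minus that at \<open>src i\<close>. On the circle, the boundary vertices to the left of
  \<open>P\<close> are the sources above \<open>src k\<close> and the sinks above
  \<open>snk j\<close>, that is, those with smaller labels; a common end lies on \<open>P\<close>
  and contributes 0.\<close>

lemma crossing_weight:
  assumes lab: "separated_labelling G pos m n src snk"
    and P: "awalk (src k) P (snk j)" and Q: "awalk (src i) Q (snk l)"
    and ijkl: "i \<in> {1..m}" "k \<in> {1..m}" "j \<in> {1..n}" "l \<in> {1..n}"
  shows "(\<Sum>f\<leftarrow>Q. \<Sum>e\<leftarrow>P. tw e f + hw f e) =
     (of_bool (k < i) - of_bool (i < k) - (of_bool (j < l) - of_bool (l < j))) / (2 :: 'k::field_char_0)"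
proof -
  have bs: "src a \<in> boundary_sources G pos" if "a \<in> {1..m}" for a
    using lab that by (auto simp: separated_labelling_def bij_betw_def)
  have bt: "snk a \<in> boundary_sinks G pos" if "a \<in> {1..n}" for a
    using lab that by (auto simp: separated_labelling_def bij_betw_def)
  have inj: "inj_on src {1..m}" "inj_on snk {1..n}"
    using lab by (auto simp: separated_labelling_def bij_betw_def)
  obtain \<theta> :: "nat \<Rightarrow> real" where mono: "strict_mono_on {1..m+n} \<theta>"
    and wrap: "\<theta> (m + n) < \<theta> 1 + 2 * pi"
    and psrc: "\<And>a. a \<in> {1..m} \<Longrightarrow> pos (src a) = cis (\<theta> a)"
    and psnk: "\<And>a. a \<in> {1..n} \<Longrightarrow> pos (snk a) = cis (\<theta> (m + n + 1 - a))"
    using lab unfolding separated_labelling_def by blast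
  have less: "\<theta> a < \<theta> b \<longleftrightarrow> a < b" if "a \<in> {1..m+n}" "b \<in> {1..m+n}" for a b
    using strict_mono_on_less[OF mono that] .
  have near: "\<theta> b < \<theta> a + 2 * pi" if "a \<in> {1..m+n}" "b \<in> {1..m+n}" for a b
  proof -
    have "\<theta> b \<le> \<theta> (m + n)" "\<theta> 1 \<le> \<theta> a"
      using that strict_mono_on_leD[OF mono] by auto
    then show ?thesis using wrap by simp
  qed
  have ccw: "ccw_points (cis (\<theta> a)) (cis (\<theta> b)) (cis (\<theta> c)) \<longleftrightarrow> b < c"
    if "a < b" "a < c" "b \<noteq> c" "a \<in> {1..m+n}" "b \<in> {1..m+n}" "c \<in> {1..m+n}" for a b c
  proof -
    have "\<theta> b \<noteq> \<theta> c" using less[of b c] less[of c b] that by (metis linorder_neqE_nat order_less_irrefl)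
    then have "ccw_points (cis (\<theta> a)) (cis (\<theta> b)) (cis (\<theta> c)) \<longleftrightarrow> \<theta> b < \<theta> c"
      using less[of a b] less[of a c] near[of a b] near[of a c] that by (intro ccw_points_cis) blast+
    then show ?thesis using less[of b c] that by blast
  qed
  have v: "src k \<in> boundary_verts G pos" "snk j \<in> boundary_verts G pos" "src k \<noteq> snk j"
    "src i \<in> boundary_verts G pos" "snk l \<in> boundary_verts G pos" "src i \<noteq> snk j" "src k \<noteq> snk l"
    using boundary_source_props[OF bs[OF ijkl(2)] bt[OF ijkl(3)]]
      boundary_source_props[OF bs[OF ijkl(1)] bt[OF ijkl(3)]]
      boundary_source_props[OF bs[OF ijkl(2)] bt[OF ijkl(4)]] by simp_all
  have vv: "src i \<in> verts G" "snk l \<in> verts G" using v by (auto simp: boundary_verts_def)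
  have ne: "P \<noteq> []" using P v(3) by (auto simp: awalk_Nil_iff)
  have sph: "pos a \<in> sphere 0 1" if "a \<in> boundary_verts G pos" for a
    using that by (simp add: boundary_verts_def)
  obtain S where conn: "\<And>C z w. \<lbrakk>topological_space_class.connected C; C \<subseteq> cball 0 1; C \<inter> walk_image P = {}; z \<in> C; w \<in> C\<rbrakk> \<Longrightarrow> S z \<longleftrightarrow> S w"
    and S: "\<And>c. \<lbrakk>c \<in> sphere 0 1; c \<notin> walk_image P\<rbrakk> \<Longrightarrow> S c \<longleftrightarrow> ccw_points (pos (snk j)) c (pos (src k))"
    and loc: "\<And>P1 x y P2 g s. \<lbrakk>P = P1 @ x # y # P2; Path_Connected.arc g; pathstart g = pos (head G x);
        \<And>s. 0 < s \<Longrightarrow> s < 1 \<Longrightarrow> g s \<in> cball 0 1 - walk_image P; 0 < s; s < 1\<rbrakk> \<Longrightarrow>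
        (ccw_curves (crv y) g (reversepath (crv x)) \<longleftrightarrow> S (g s)) \<and>
        (ccw_curves g (crv y) (reversepath (crv x)) \<longleftrightarrow> \<not> S (g s))"
    using walk_side[OF P ne sph[OF v(1)] sph[OF v(2)]] by blast
  define w :: "'a \<Rightarrow> 'k" where
    "w a = (if a \<in> set (awalk_verts (src k) P) then 0 else of_bool (S (pos a)) - 1 / 2)" for a
  have "(\<Sum>e\<leftarrow>P. tw e f + hw f e) = w (head G f) - w (tail G f)" if "f \<in> set Q" for f
  proof -
    have "f \<in> arcs G" using that Q by auto
    then have "(\<Sum>e\<in>set P. tw e f + hw f e) = w (head G f) - w (tail G f)"
      by (intro weight_step[OF P ne v(1,2) conn loc w_def])
    then show ?thesis using walk_distinct[OF P] by (simp add: sum_list_distinct_conv_sum_set)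
  qed
  then have "(\<Sum>f\<leftarrow>Q. \<Sum>e\<leftarrow>P. tw e f + hw f e) = (\<Sum>f\<leftarrow>Q. w (head G f) - w (tail G f))"
    by (intro arg_cong[of _ _ sum_list] map_cong) auto
  also have "\<dots> = w (snk l) - w (src i)" by (rule telescope_walk[OF Q])
  also have "w (snk l) = (of_bool (l < j) - of_bool (j < l)) / 2"
  proof (cases "l = j")
    case True
    have "awlast (src k) P = snk j" using P by (simp only: awalk_conv)
    then have "snk j \<in> set (awalk_verts (src k) P)"
      using last_in_set[OF awalk_verts_non_Nil, of "src k" P] by metis
    then show ?thesis using True by (simp add: w_def)
  next
    case False
    then have "snk l \<noteq> snk j" using inj_on_eq_iff[OF inj(2) ijkl(4,3)] by simp
    then have off: "snk l \<notin> set (awalk_verts (src k) P)"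
      using walk_boundary_vertex[OF P _ v(5)] v(7) by auto
    then have "pos (snk l) \<notin> walk_image P"
      by (rule vertex_off_walk[OF P vv(2)])
    then have "S (pos (snk l)) \<longleftrightarrow> ccw_points (pos (snk j)) (pos (snk l)) (pos (src k))"
      using S sph v by blast
    \<comment> \<open>Rotated so that the smallest position on the circle comes first, as
      \<open>ccw\<close> demands. Sinks have the positions \<open>m + n + 1 - j\<close>, so a higher
      sink comes later.\<close>
    also have "\<dots> \<longleftrightarrow> ccw_points (cis (\<theta> k)) (cis (\<theta> (m + n + 1 - j))) (cis (\<theta> (m + n + 1 - l)))"
      using psrc psnk ijkl ccw_points_rotate by metis
    also have "\<dots> \<longleftrightarrow> l < j" using ijkl False by (subst ccw) auto
    finally show ?thesis using off False by (auto simp: w_def)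
  qed
  also have "w (src i) = (of_bool (i < k) - of_bool (k < i)) / 2"
  proof (cases "i = k")
    case True
    then show ?thesis using hd_in_awalk_verts(1)[OF P] by (simp add: w_def)
  next
    case False
    then have "src i \<noteq> src k" using inj_on_eq_iff[OF inj(1) ijkl(1,2)] by simp
    then have off: "src i \<notin> set (awalk_verts (src k) P)"
      using walk_boundary_vertex[OF P _ v(4)] v(6) by auto
    then have "pos (src i) \<notin> walk_image P"
      by (rule vertex_off_walk[OF P vv(1)])
    then have Si: "S (pos (src i)) \<longleftrightarrow> ccw_points (pos (snk j)) (pos (src i)) (pos (src k))"
      using S sph v by blast
    \<comment> \<open>Which of the three positions is the smallest depends on the order of
      \<open>i\<close> and \<open>k\<close>, hence the case distinction.\<close>
    have "S (pos (src i)) \<longleftrightarrow> i < k"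
    proof (cases "i < k")
      case True
      have "S (pos (src i)) \<longleftrightarrow> ccw_points (cis (\<theta> i)) (cis (\<theta> k)) (cis (\<theta> (m + n + 1 - j)))"
        unfolding Si using psrc psnk ijkl ccw_points_rotate by metis
      also have "\<dots> \<longleftrightarrow> k < m + n + 1 - j" using ijkl True by (intro ccw) auto
      finally show ?thesis using True ijkl by auto
    next
      case False
      have "S (pos (src i)) \<longleftrightarrow> ccw_points (cis (\<theta> k)) (cis (\<theta> (m + n + 1 - j))) (cis (\<theta> i))"
        unfolding Si using psrc psnk ijkl ccw_points_rotate by metis
      also have "\<dots> \<longleftrightarrow> m + n + 1 - j < i" using ijkl False \<open>i \<noteq> k\<close> by (intro ccw) auto
      finally show ?thesis using False ijkl by auto
    qed
    then show ?thesis using off False by (auto simp: w_def)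
  qed
  finally show ?thesis by (simp add: diff_divide_distrib)
qed

end

section \<open>Bilinear algebra of finitely supported functions\<close>

abbreviation basis :: "'a \<Rightarrow> 'a \<Rightarrow>\<^sub>0 'k::field_char_0" where
  "basis x \<equiv> Poly_Mapping.single x 1"

lemma lookup_smul [simp]: "Poly_Mapping.lookup (smul c f) x = c * Poly_Mapping.lookup f x"
  by (simp add: smul_def Poly_Mapping.map.rep_eq when_def)

lemma smul_simps [simp]:
  "smul 0 f = 0" "smul c 0 = 0" "smul 1 f = f" "smul c (smul d f) = smul (c * d) f"
  "smul c (Poly_Mapping.single x d) = Poly_Mapping.single x (c * d)"
  by (auto intro!: poly_mapping_eqI simp: lookup_single when_def)

lemma smul_add_scalar: "smul (c + d) f = smul c f + smul d f"
  by (auto intro!: poly_mapping_eqI simp: lookup_add algebra_simps)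

lemma smul_sum: "smul c (\<Sum>i\<in>I. f i) = (\<Sum>i\<in>I. smul c (f i))"
  by (auto intro!: poly_mapping_eqI simp: lookup_sum sum_distrib_left)

lemma smul_sum_scalar: "smul (\<Sum>i\<in>I. c i) f = (\<Sum>i\<in>I. smul (c i) f)"
  by (auto intro!: poly_mapping_eqI simp: lookup_sum sum_distrib_right)

text \<open>The keys of a sum or of a multiple can be fewer than those of its parts. Over a fixed
  finite superset the extra terms vanish, and linearity can be read off term by term.\<close>

lemma bilinear_ext_superset:
  assumes "finite A" "Poly_Mapping.keys f \<subseteq> A" "finite B" "Poly_Mapping.keys g \<subseteq> B"
  shows "bilinear_ext b f g =
    (\<Sum>p\<in>A. \<Sum>q\<in>B. smul (Poly_Mapping.lookup f p * Poly_Mapping.lookup g q) (b p q))"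
proof -
  have "bilinear_ext b f g = (\<Sum>p\<in>Poly_Mapping.keys f. \<Sum>q\<in>B.
      smul (Poly_Mapping.lookup f p * Poly_Mapping.lookup g q) (b p q))"
    unfolding bilinear_ext_def using assms
    by (intro sum.cong sum.mono_neutral_left) (auto simp: in_keys_iff)
  also have "\<dots> = (\<Sum>p\<in>A. \<Sum>q\<in>B. smul (Poly_Mapping.lookup f p * Poly_Mapping.lookup g q) (b p q))"
    using assms by (intro sum.mono_neutral_left) (auto simp: in_keys_iff)
  finally show ?thesis .
qed

lemma bilinear_ext_add_left: "bilinear_ext b (f + f') g = bilinear_ext b f g + bilinear_ext b f' g"
proof -
  let ?A = "Poly_Mapping.keys f \<union> Poly_Mapping.keys f'" and ?B = "Poly_Mapping.keys g"
  have "bilinear_ext b h g = (\<Sum>p\<in>?A. \<Sum>q\<in>?B. smul (Poly_Mapping.lookup h p * Poly_Mapping.lookup g q) (b p q))"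
    if "Poly_Mapping.keys h \<subseteq> ?A" for h
    using that by (intro bilinear_ext_superset) auto
  moreover have "Poly_Mapping.keys (f + f') \<subseteq> ?A" by (rule keys_add)
  ultimately show ?thesis
    by (simp add: lookup_add algebra_simps smul_add_scalar sum.distrib)
qed

lemma bilinear_ext_add_right: "bilinear_ext b f (g + g') = bilinear_ext b f g + bilinear_ext b f g'"
proof -
  let ?A = "Poly_Mapping.keys f" and ?B = "Poly_Mapping.keys g \<union> Poly_Mapping.keys g'"
  have "bilinear_ext b f h = (\<Sum>p\<in>?A. \<Sum>q\<in>?B. smul (Poly_Mapping.lookup f p * Poly_Mapping.lookup h q) (b p q))"
    if "Poly_Mapping.keys h \<subseteq> ?B" for h
    using that by (intro bilinear_ext_superset) auto
  moreover have "Poly_Mapping.keys (g + g') \<subseteq> ?B" by (rule keys_add)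
  ultimately show ?thesis
    by (simp add: lookup_add algebra_simps smul_add_scalar sum.distrib)
qed

lemma keys_smul: "Poly_Mapping.keys (smul c f) \<subseteq> Poly_Mapping.keys f"
  by (auto simp: in_keys_iff)

lemma bilinear_ext_smul_left: "bilinear_ext b (smul c f) g = smul c (bilinear_ext b f g)"
  by (subst bilinear_ext_superset[of "Poly_Mapping.keys f" _ "Poly_Mapping.keys g"])
     (auto simp: keys_smul bilinear_ext_def smul_sum mult.assoc)

lemma bilinear_ext_smul_right: "bilinear_ext b f (smul c g) = smul c (bilinear_ext b f g)"
  by (subst bilinear_ext_superset[of "Poly_Mapping.keys f" _ "Poly_Mapping.keys g"])
     (auto simp: keys_smul bilinear_ext_def smul_sum mult_ac)

lemma bilinear_ext_zero [simp]: "bilinear_ext b 0 g = 0" "bilinear_ext b f 0 = 0"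
  by (simp_all add: bilinear_ext_def)

lemma bilinear_ext_sum_left: "bilinear_ext b (\<Sum>i\<in>I. f i) g = (\<Sum>i\<in>I. bilinear_ext b (f i) g)"
  by (induction I rule: infinite_finite_induct) (auto simp: bilinear_ext_add_left)

lemma bilinear_ext_sum_right: "bilinear_ext b f (\<Sum>i\<in>I. g i) = (\<Sum>i\<in>I. bilinear_ext b f (g i))"
  by (induction I rule: infinite_finite_induct) (auto simp: bilinear_ext_add_right)

lemma bilinear_ext_basis [simp]: "bilinear_ext b (basis p) (basis q) = b p q"
  by (simp add: bilinear_ext_def)

lemmas bilinear_ext_simps = bilinear_ext_add_left bilinear_ext_add_right bilinear_ext_sum_left
  bilinear_ext_sum_right bilinear_ext_smul_left bilinear_ext_smul_right

text \<open>The unit law is demanded only on the keys of \<open>t\<close>, because the identity of a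
  vertex acts trivially only on paths that start there.\<close>

lemma bilinear_ext_unit_left:
  assumes "\<And>q. q \<in> Poly_Mapping.keys t \<Longrightarrow> b u q = basis q"
  shows "bilinear_ext b (basis u) t = t"
  using assms
  by (auto intro!: poly_mapping_eqI
      simp: bilinear_ext_def lookup_sum lookup_single when_def sum.delta' in_keys_iff)

lemma bilinear_ext_unit_right:
  assumes "\<And>q. q \<in> Poly_Mapping.keys t \<Longrightarrow> b q u = basis q"
  shows "bilinear_ext b t (basis u) = t"
  using assms
  by (auto intro!: poly_mapping_eqI
      simp: bilinear_ext_def lookup_sum lookup_single when_def sum.delta' in_keys_iff)

lemma tensor_basis [simp]: "tensor (basis p) (basis q) = basis (p, q)"
  by (simp add: tensor_def)

lemma tens_comp_basis [simp]:
  "tens_comp G (basis (p, p')) (basis (q, q')) =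
     (if pre_digraph.cas G (fst p) (snd p) (fst q) \<and> pre_digraph.cas G (fst p') (snd p') (fst q')
      then basis ((fst p, snd p @ snd q), (fst p', snd p' @ snd q')) else 0)"
  by (simp add: tens_comp_def path_comp_def tensor_def)

lemma mor_comp_basis [simp]:
  "mor_comp G (basis p) (basis q) =
     (if pre_digraph.cas G (fst p) (snd p) (fst q) then basis (fst p, snd p @ snd q) else 0)"
  by (simp add: mor_comp_def path_comp_def)

lemma tens_comp_simps:
  "tens_comp G (s + s') t = tens_comp G s t + tens_comp G s' t"
  "tens_comp G s (t + t') = tens_comp G s t + tens_comp G s t'"
  "tens_comp G (\<Sum>i\<in>I. f i) t = (\<Sum>i\<in>I. tens_comp G (f i) t)"
  "tens_comp G s (\<Sum>i\<in>I. f i) = (\<Sum>i\<in>I. tens_comp G s (f i))"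
  "tens_comp G (smul c s) t = smul c (tens_comp G s t)"
  "tens_comp G s (smul c t) = smul c (tens_comp G s t)"
  by (simp_all add: tens_comp_def bilinear_ext_simps)

lemma lookup_tau [simp]: "Poly_Mapping.lookup (tau t) x = Poly_Mapping.lookup t (prod.swap x)"
  unfolding tau_def by (simp add: Poly_Mapping.map_key.rep_eq)

lemma tau_smul: "tau (smul c t) = smul c (tau t)"
  and tau_zero: "tau 0 = 0"
  and tau_basis: "tau (basis (p, q)) = basis (q, p)"
  and tau_add: "tau (s + t) = tau s + tau t"
  and tau_sum: "tau (\<Sum>i\<in>I. f i) = (\<Sum>i\<in>I. tau (f i))"
  by (auto intro!: poly_mapping_eqI simp: lookup_sum lookup_add lookup_single when_def)

lemma tau_tensor_sums:
  "tau (tensor (\<Sum>p\<in>A. basis (f p)) (\<Sum>q\<in>B. basis (g q))) =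
     tensor (\<Sum>q\<in>B. basis (g q)) (\<Sum>p\<in>A. basis (f p))"
  unfolding tensor_def bilinear_ext_simps tau_sum bilinear_ext_basis tau_basis by (rule sum.swap)

text \<open>Under \<tau> the contributions of the pair \<open>f\<close>, \<open>e\<close> turn into
  multiples of the same tensors as those of \<open>e\<close>, \<open>f\<close>. The negative
  coefficient at black vertices is why \<open>head_weight\<close> takes its two turns in the
  opposite order.\<close>

lemma edge_bracket_weights:
  "(edge_bracket G pos crv e f :: ('a, 'b, 'd::field_char_0) tens) =
     smul (tail_weight G pos crv e f) (basis ((tail G e, [e]), (tail G f, [f]))) +
     smul (head_weight G pos crv e f) (basis ((tail G f, [f]), (tail G e, [e])))"
proof -
  let ?ef = "basis ((tail G e, [e]), (tail G f, [f]))" and ?fe = "basis ((tail G f, [f]), (tail G e, [e]))"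
  have w: "white_contrib G pos crv v x y =
      smul (of_bool (white_turn G pos crv v x y) / 2) (basis ((tail G x, [x]), (tail G y, [y])))" for v x y
    unfolding white_contrib_def white_turn_def[symmetric] by (simp add: edge_def)
  have b: "black_contrib G pos crv v x y =
      smul (- of_bool (black_turn G pos crv v x y) / 2) (basis ((tail G y, [y]), (tail G x, [x])))" for v x y
    unfolding black_contrib_def black_turn_def[symmetric] by (simp add: edge_def)
  have ring: "x / 2 * X + - y / 2 * Y - (x' / 2 * X + - y' / 2 * Y) = (x - x') / 2 * X + (y' - y) / 2 * Y"
    for x x' y y' X Y :: 'd
    by (simp add: field_simps)
  have "(vertex_contrib G pos crv v e f - tau (vertex_contrib G pos crv v f e) :: ('a, 'b, 'd) tens) =
      smul ((of_bool (white_turn G pos crv v e f) - of_bool (white_turn G pos crv v f e)) / 2) ?ef +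
      smul ((of_bool (black_turn G pos crv v f e) - of_bool (black_turn G pos crv v e f)) / 2) ?fe" for v
    unfolding vertex_contrib_def w b tau_add tau_smul tau_basis
    by (rule poly_mapping_eqI)
       (simp only: lookup_add lookup_minus lookup_smul ring)
  then show ?thesis
    by (simp only: edge_bracket_def tail_weight_def head_weight_def sum.distrib smul_sum_scalar)
qed


section \<open>The bracket of two walks\<close>

text \<open>The cut at the tail of the edge serves meetings at a common tail, the cut at its head
  those at a common head.\<close>

lemma (in acyclic_planar_network) walk_at:
  assumes "awalk u p v" "a < length p"
  shows "awalk u (take a p) (tail G (p ! a))" "awalk (tail G (p ! a)) (drop a p) v"
    "awalk u (take (Suc a) p) (head G (p ! a))" "awalk (head G (p ! a)) (drop (Suc a) p) v"
proof -
  have "awalk u (take a p @ p ! a # drop (Suc a) p) v"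
    by (simp only: id_take_nth_drop[OF assms(2), symmetric] assms(1))
  then have a: "awalk u (take a p) (awlast u (take a p))"
      "awalk (awlast u (take a p)) (p ! a # drop (Suc a) p) v"
    by (simp_all only: awalk_append_iff)
  have t: "awlast u (take a p) = tail G (p ! a)" using a(2) by (simp only: awalk_Cons_iff)
  show 1: "awalk u (take a p) (tail G (p ! a))" using a(1) unfolding t .
  show "awalk (tail G (p ! a)) (drop a p) v"
    using a(2) assms(2) unfolding t by (simp only: Cons_nth_drop_Suc)
  show "awalk (head G (p ! a)) (drop (Suc a) p) v" and "awalk u (take (Suc a) p) (head G (p ! a))"
    using a(2) awalk_appendI[OF 1 arc_implies_awalk]
    by (simp_all only: awalk_Cons_iff take_Suc_conv_app_nth[OF assms(2)])
qed

locale network_bracket = acyclic_planar_network G pos crv + standard_double_bracket G pos crv br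
  for G :: "('v, 'e) pre_digraph" and pos crv
    and br :: "('v, 'e, 'k::field_char_0) mor \<Rightarrow> ('v, 'e, 'k) mor \<Rightarrow> ('v, 'e, 'k) tens"
begin

lemma basis_in_Hom: "awalk u p v \<Longrightarrow> basis (u, p) \<in> Hom G u v"
  by (auto simp: Hom_def paths_def)

lemma edge_in_Hom: "e \<in> arcs G \<Longrightarrow> edge G e \<in> Hom G (tail G e) (head G e)"
  unfolding edge_def by (intro basis_in_Hom arc_implies_awalk)

lemma ident_in_Hom: "v \<in> verts G \<Longrightarrow> ident v \<in> Hom G v v"
  unfolding ident_def by (intro basis_in_Hom) (simp add: awalk_Nil_iff)

text \<open>The Leibniz rule for the product of the identity with itself yields
  \<open>t = t + t\<close> for the bracket \<open>t\<close>. The identities act trivially on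
  \<open>t\<close> because \<open>t\<close> lies in its prescribed tensor product of Hom
  spaces.\<close>

lemma bracket_ident_right:
  assumes f: "f \<in> Hom G A A'" and D: "D \<in> verts G"
  shows "br f (ident D) = 0"
proof -
  let ?t = "br f (ident D)"
  have t: "Poly_Mapping.keys ?t \<subseteq> paths G D A' \<times> paths G A D"
    using bracket_in_HomTens[OF f ident_in_Hom[OF D]] by (simp add: HomTens_def)
  have "?t = br f (mor_comp G (ident D) (ident D))" by (simp add: ident_def)
  also have "\<dots> = tens_comp G (tensor (ident D) (ident A)) ?t + tens_comp G ?t (tensor (ident A') (ident D))"
    by (rule leibniz_right[OF f ident_in_Hom[OF D] ident_in_Hom[OF D]])
  also have "tens_comp G (tensor (ident D) (ident A)) ?t = ?t"
    unfolding tens_comp_def ident_def tensor_basis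
  proof (rule bilinear_ext_unit_left)
    fix q assume "q \<in> Poly_Mapping.keys (br f (Poly_Mapping.single (D, []) 1))"
    then obtain es fs where "q = ((D, es), (A, fs))" using t by (auto simp: paths_def ident_def)
    then show "(case ((D, []), (A, [])) of (p, p') \<Rightarrow> \<lambda>(q, q'). tensor (path_comp G p q) (path_comp G p' q')) q
      = basis q"
      by (simp add: path_comp_def)
  qed
  also have "tens_comp G ?t (tensor (ident A') (ident D)) = ?t"
    unfolding tens_comp_def ident_def tensor_basis
  proof (rule bilinear_ext_unit_right)
    fix q assume "q \<in> Poly_Mapping.keys (br f (Poly_Mapping.single (D, []) 1))"
    then obtain es fs where "q = ((D, es), (A, fs))" "awalk D es A'" "awalk A fs D"
      using t by (auto simp: paths_def ident_def)
    then show "(case q of (p, p') \<Rightarrow> \<lambda>(q, q'). tensor (path_comp G p q) (path_comp G p' q')) ((A', []), (D, []))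
      = basis q"
      by (simp add: path_comp_def awalk_def)
  qed
  finally show ?thesis by simp
qed

lemma bracket_ident_left:
  assumes g: "g \<in> Hom G D D'" and A: "A \<in> verts G"
  shows "br (ident A) g = 0"
  using skew_symmetric[OF ident_in_Hom[OF A] g] bracket_ident_right[OF g A] by (simp add: tau_zero)

text \<open>All positions are listed, also those without a common tail or head. There the pairs of
  edge lists need not be walks, but their weights are 0; this keeps the index sets simple for the
  induction.\<close>

lemma bracket_edge_walk:
  assumes "e \<in> arcs G" "awalk D fs D'"
  shows "br (edge G e) (basis (D, fs)) =
    (\<Sum>b<length fs. smul (tw e (fs ! b)) (basis ((D, take b fs @ [e]), (tail G e, drop b fs)))
      + smul (hw e (fs ! b)) (basis ((D, take (Suc b) fs), (tail G e, e # drop (Suc b) fs))))"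
  using assms(2)
proof (induction fs arbitrary: D)
  case Nil
  then show ?case
    using bracket_ident_right[OF edge_in_Hom[OF assms(1)], of D] by (auto simp: ident_def awalk_Nil_iff)
next
  case (Cons f fs)
  have f: "f \<in> arcs G" "D = tail G f" and w: "awalk (head G f) fs D'"
    using Cons.prems by (auto simp: awalk_Cons_iff)
  have "(basis (D, f # fs) :: ('v, 'e, 'k) mor) = mor_comp G (edge G f) (basis (head G f, fs))"
    by (simp add: edge_def f)
  then have "br (edge G e) (basis (D, f # fs)) =
      tens_comp G (tensor (edge G f) (ident (tail G e))) (br (edge G e) (basis (head G f, fs)))
      + tens_comp G (br (edge G e) (edge G f)) (tensor (ident (head G e)) (basis (head G f, fs)))"
    using leibniz_right[OF edge_in_Hom[OF assms(1)] edge_in_Hom[OF f(1)] basis_in_Hom[OF w]] by (simp only:)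
  also have "tens_comp G (br (edge G e) (edge G f)) (tensor (ident (head G e)) (basis (head G f, fs)))
      = smul (tw e f) (basis ((D, [e]), (tail G e, f # fs)))
      + smul (hw e f) (basis ((D, [f]), (tail G e, e # fs)))"
  proof -
    have "smul (tw e f) (tens_comp G (basis ((tail G e, [e]), (tail G f, [f]))) (basis ((head G e, []), (head G f, fs))))
      = (smul (tw e f) (basis ((D, [e]), (tail G e, f # fs))) :: ('v, 'e, 'k) tens)"
      by (cases "tail G e = tail G f") (simp_all add: f tail_weight_zero)
    moreover have "smul (hw e f) (tens_comp G (basis ((tail G f, [f]), (tail G e, [e]))) (basis ((head G e, []), (head G f, fs))))
      = (smul (hw e f) (basis ((D, [f]), (tail G e, e # fs))) :: ('v, 'e, 'k) tens)"
      by (cases "head G e = head G f") (simp_all add: f head_weight_zero)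
    ultimately show ?thesis
      unfolding bracket_edges[OF assms(1) f(1)] unfolding edge_bracket_weights ident_def tensor_basis tens_comp_simps
      by (simp only:)
  qed
  also have "tens_comp G (tensor (edge G f) (ident (tail G e))) (br (edge G e) (basis (head G f, fs)))
     = (\<Sum>b<length fs. smul (tw e (fs ! b)) (basis ((D, f # take b fs @ [e]), (tail G e, drop b fs)))
      + smul (hw e (fs ! b)) (basis ((D, f # take (Suc b) fs), (tail G e, e # drop (Suc b) fs))))"
    unfolding Cons.IH[OF w] unfolding edge_def ident_def tensor_basis tens_comp_simps
    by (intro sum.cong) (simp_all add: f)
  finally show ?case
    by (simp add: sum.lessThan_Suc_shift add.commute del: smul_simps sum.lessThan_Suc)
qed

text \<open>The Leibniz rule removes the edges of \<open>es\<close> one at a time. At a common tail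
  both walks are cut before the meeting edges, at a common head after them, and the tails are
  exchanged.\<close>

lemma bracket_walk_walk:
  assumes "awalk A es A'" "awalk D fs D'"
  shows "br (basis (A, es)) (basis (D, fs)) = (\<Sum>a<length es. \<Sum>b<length fs.
      smul (tw (es ! a) (fs ! b)) (basis ((D, take b fs @ drop a es), (A, take a es @ drop b fs)))
    + smul (hw (es ! a) (fs ! b))
        (basis ((D, take (Suc b) fs @ drop (Suc a) es), (A, take (Suc a) es @ drop (Suc b) fs))))"
  using assms(1)
proof (induction es arbitrary: A)
  case Nil
  then show ?case
    using bracket_ident_left[OF basis_in_Hom[OF assms(2)], of A] by (auto simp: ident_def awalk_Nil_iff)
next
  case (Cons e es)
  have e: "e \<in> arcs G" "A = tail G e" and w: "awalk (head G e) es A'"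
    using Cons.prems by (auto simp: awalk_Cons_iff)
  have "(basis (A, e # es) :: ('v, 'e, 'k) mor) = mor_comp G (edge G e) (basis (head G e, es))"
    by (simp add: edge_def e)
  then have "br (basis (A, e # es)) (basis (D, fs)) =
      tens_comp G (tensor (ident D) (edge G e)) (br (basis (head G e, es)) (basis (D, fs)))
      + tens_comp G (br (edge G e) (basis (D, fs))) (tensor (basis (head G e, es)) (ident D'))"
    using leibniz_left[OF edge_in_Hom[OF e(1)] basis_in_Hom[OF w] basis_in_Hom[OF assms(2)]] by (simp only:)
  also have "tens_comp G (br (edge G e) (basis (D, fs))) (tensor (basis (head G e, es)) (ident D'))
      = (\<Sum>b<length fs. smul (tw e (fs ! b)) (basis ((D, take b fs @ e # es), (A, drop b fs)))
      + smul (hw e (fs ! b)) (basis ((D, take (Suc b) fs @ es), (A, e # drop (Suc b) fs))))"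
    unfolding bracket_edge_walk[OF e(1) assms(2)] unfolding ident_def tensor_basis tens_comp_simps
  proof (intro sum.cong refl arg_cong2[of _ _ _ _ "(+)"])
    fix b assume "b \<in> {..<length fs}"
    then have b: "b < length fs" by simp
    note at = walk_at[OF assms(2) b]
    show "smul (tw e (fs ! b)) (tens_comp G (basis ((D, take b fs @ [e]), (tail G e, drop b fs)))
          (basis ((head G e, es), (D', []))))
      = smul (tw e (fs ! b)) (basis ((D, take b fs @ e # es), (A, drop b fs)) :: ('v, 'e, 'k) tens)"
    proof (cases "tail G e = tail G (fs ! b)")
      case True
      have "awalk D (take b fs @ [e]) (head G e)"
        using awalk_appendI[OF at(1)[folded True] arc_implies_awalk[OF e(1)]] .
      then have "cas D (take b fs @ [e]) (head G e)" "cas (tail G e) (drop b fs) D'"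
        using at(2) True unfolding awalk_def by simp_all
      then show ?thesis by (simp add: e del: cas_append_iff)
    next
      case False
      then have "tw e (fs ! b) = (0 :: 'k)" by (intro tail_weight_zero) simp
      then show ?thesis by simp
    qed
    show "smul (hw e (fs ! b)) (tens_comp G (basis ((D, take (Suc b) fs), (tail G e, e # drop (Suc b) fs)))
          (basis ((head G e, es), (D', []))))
      = smul (hw e (fs ! b)) (basis ((D, take (Suc b) fs @ es), (A, e # drop (Suc b) fs)) :: ('v, 'e, 'k) tens)"
    proof (cases "head G e = head G (fs ! b)")
      case True
      have "cas D (take (Suc b) fs) (head G e)" "cas (tail G e) (e # drop (Suc b) fs) D'"
        using at(3,4) True unfolding awalk_def by simp_all
      then show ?thesis by (simp add: e)
    next
      case False
      then have "hw e (fs ! b) = (0 :: 'k)" by (intro head_weight_zero) simp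
      then show ?thesis by simp
    qed
  qed
  also have "tens_comp G (tensor (ident D) (edge G e)) (br (basis (head G e, es)) (basis (D, fs)))
     = (\<Sum>a<length es. \<Sum>b<length fs.
      smul (tw (es ! a) (fs ! b)) (basis ((D, take b fs @ drop a es), (A, e # take a es @ drop b fs)))
    + smul (hw (es ! a) (fs ! b))
        (basis ((D, take (Suc b) fs @ drop (Suc a) es), (A, e # take (Suc a) es @ drop (Suc b) fs))))"
    unfolding Cons.IH[OF w] unfolding edge_def ident_def tensor_basis tens_comp_simps
    by (intro sum.cong) (simp_all add: e)
  finally show ?case
    by (simp add: sum.lessThan_Suc_shift add.commute del: smul_simps sum.lessThan_Suc)
qed

end

section \<open>Exchanging the tails of two walks\<close>

lemma nested_list_sum:
  assumes "finite A" "finite B" "\<And>p q a b. \<not> R p q a b \<Longrightarrow> h p q a b = 0"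
  shows "(\<Sum>p\<in>A. \<Sum>q\<in>B. \<Sum>a<length p. \<Sum>b<length q. h p q a b) =
    (\<Sum>(p, q, a, b)\<in>{(p, q, a, b). p \<in> A \<and> q \<in> B \<and> a < length p \<and> b < length q \<and> R p q a b}. h p q a b)"
proof -
  let ?Z = "SIGMA p:A. SIGMA q:B. {..<length p} \<times> {..<length q}"
  have "(\<Sum>p\<in>A. \<Sum>q\<in>B. \<Sum>a<length p. \<Sum>b<length q. h p q a b) = (\<Sum>(p, q, a, b)\<in>?Z. h p q a b)"
    using assms(1,2) by (simp add: sum.Sigma sum.cartesian_product split_def)
  also have "\<dots> = (\<Sum>(p, q, a, b)\<in>{(p, q, a, b). p \<in> A \<and> q \<in> B \<and> a < length p \<and> b < length q \<and> R p q a b}. h p q a b)"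
    using assms by (intro sum.mono_neutral_right) (auto intro!: finite_SigmaI)
  finally show ?thesis .
qed

text \<open>\<open>s = 0\<close> cuts both walks before their marked edges (common tail),
  \<open>s = 1\<close> after them (common head). The first new walk begins like \<open>q\<close> and
  inherits its position \<open>b\<close>, hence the result ends in \<open>b, a\<close>; with this
  order the map is an involution.\<close>

definition exchange :: "nat \<Rightarrow> 'e list \<times> 'e list \<times> nat \<times> nat \<Rightarrow> 'e list \<times> 'e list \<times> nat \<times> nat" where
  "exchange s = (\<lambda>(p, q, a, b).
     (take (b + s) q @ drop (a + s) p, take (a + s) p @ drop (b + s) q, b, a))"

lemma exchange_exchange:
  assumes "a < length p" "b < length q" "s \<le> 1"
  shows "exchange s (exchange s (p, q, a, b)) = (p, q, a, b)"
  using assms by (simp add: exchange_def)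

text \<open>For \<open>s = 0\<close> the marked edges belong to the exchanged tails, for
  \<open>s = 1\<close> they stay with the initial parts. This is why the head weights get their
  arguments interchanged when expressed by the new walks.\<close>

lemma exchange_nth:
  assumes "a < length p" "b < length q" "exchange s (p, q, a, b) = (P, Q, b', a')"
  shows "s = 0 \<Longrightarrow> P ! b' = p ! a \<and> Q ! a' = q ! b" "s = 1 \<Longrightarrow> P ! b' = q ! b \<and> Q ! a' = p ! a"
  using assms by (auto simp: exchange_def nth_append)

context acyclic_planar_network
begin

definition end_at :: "nat \<Rightarrow> 'b \<Rightarrow> 'a" where
  "end_at s e = (if s = 0 then tail G e else head G e)"

definition meetings :: "nat \<Rightarrow> 'a \<Rightarrow> 'a \<Rightarrow> 'a \<Rightarrow> 'a \<Rightarrow> ('b list \<times> 'b list \<times> nat \<times> nat) set" where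
  "meetings s u v u' v' = {(p, q, a, b). p \<in> {p. awalk u p v} \<and> q \<in> {q. awalk u' q v'} \<and>
     a < length p \<and> b < length q \<and> end_at s (p ! a) = end_at s (q ! b)}"

lemma exchange_meetings:
  assumes x: "x \<in> meetings s u v u' v'" and s: "s = 0 \<or> s = 1"
  shows "exchange s x \<in> meetings s u' v u v'"
proof -
  obtain p q a b where xx: "x = (p, q, a, b)" and p: "awalk u p v" "a < length p"
    and q: "awalk u' q v'" "b < length q" and m: "end_at s (p ! a) = end_at s (q ! b)"
    using x by (auto simp: meetings_def)
  let ?w = "end_at s (p ! a)"
  have cut: "awalk u (take (a + s) p) ?w" "awalk ?w (drop (a + s) p) v"
    using walk_at[OF p] s by (auto simp: end_at_def)
  have "awalk u' (take (b + s) q) ?w" "awalk ?w (drop (b + s) q) v'"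
    unfolding m using walk_at[OF q] s by (auto simp: end_at_def)
  with cut have w: "awalk u' (take (b + s) q @ drop (a + s) p) v" "awalk u (take (a + s) p @ drop (b + s) q) v'"
    by (blast intro: awalk_appendI)+
  obtain P Q where e: "exchange s (p, q, a, b) = (P, Q, b, a)"
    "P = take (b + s) q @ drop (a + s) p" "Q = take (a + s) p @ drop (b + s) q"
    by (simp add: exchange_def)
  have "b < length P" "a < length Q" using p q s by (auto simp: e)
  moreover have "end_at s (P ! b) = end_at s (Q ! a)"
    using exchange_nth[OF p(2) q(2) e(1)] s m by auto
  ultimately show ?thesis
    unfolding xx e(1) using w by (simp add: meetings_def e(2,3) del: awalk_append_iff)
qed

text \<open>A change of variables along the involution; the initial vertices keep their walks'
  beginnings while the final vertices trade places.\<close>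

lemma sum_meetings_exchange:
  assumes s: "s = 0 \<or> s = 1"
    and h: "\<And>p q a b P Q b' a'. \<lbrakk>a < length p; b < length q; exchange s (p, q, a, b) = (P, Q, b', a')\<rbrakk>
      \<Longrightarrow> h (p, q, a, b) = h' (P, Q, b', a')"
  shows "(\<Sum>x\<in>meetings s u v u' v'. h x) = (\<Sum>y\<in>meetings s u' v u v'. h' y)"
proof -
  have inv: "exchange s (exchange s x) = x" if "x \<in> meetings s w1 w2 w3 w4" for x w1 w2 w3 w4
  proof -
    obtain p q a b where x: "x = (p, q, a, b)" by (cases x)
    then have "a < length p" "b < length q" using that by (simp_all add: meetings_def)
    then show ?thesis unfolding x using s by (intro exchange_exchange) auto
  qed
  show ?thesis
  proof (rule sum.reindex_bij_witness[where i = "exchange s" and j = "exchange s"])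
  fix x assume "x \<in> meetings s u v u' v'"
  moreover obtain p q a b where x: "x = (p, q, a, b)" by (cases x)
  ultimately have "a < length p" "b < length q" by (simp_all add: meetings_def)
  then show "h' (exchange s x) = h x"
    unfolding x using h by (metis prod_cases4)
  qed (use inv exchange_meetings[OF _ s] in blast)+
qed

lemma finite_walks: "finite {p. awalk u p v}"
  unfolding awalk_iff_apath using apaths_finite by simp

lemma sum_over_lists: "(\<Sum>a<length xs. f (xs ! a)) = (\<Sum>x\<leftarrow>xs. f x)"
  by (simp add: sum_list_sum_nth atLeast0LessThan)

end

section \<open>Brackets of sums over all walks\<close>

context network_bracket
begin

lemma Hom_zero: "0 \<in> Hom G A A'"
  by (simp add: Hom_def)

lemma Hom_sum: "(\<And>i. i \<in> I \<Longrightarrow> f i \<in> Hom G A A') \<Longrightarrow> (\<Sum>i\<in>I. f i) \<in> Hom G A A'"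
  using keys_sum[of f I] by (fastforce simp: Hom_def)

lemma bracket_zero:
  assumes "f \<in> Hom G A A'"
  shows "br 0 f = 0" "br f 0 = 0"
  using smul_left[OF Hom_zero assms, of 0] smul_right[OF assms Hom_zero, of 0] by simp_all

lemma bracket_sum_left:
  assumes "\<And>i. i \<in> I \<Longrightarrow> f i \<in> Hom G A A'" "g \<in> Hom G D D'"
  shows "br (\<Sum>i\<in>I. f i) g = (\<Sum>i\<in>I. br (f i) g)"
  using assms
proof (induction I rule: infinite_finite_induct)
  case (insert i I)
  then show ?case using add_left[of "f i" A A' "\<Sum>i\<in>I. f i" g D D'] Hom_sum[of I f A A'] by simp
qed (use bracket_zero in auto)

lemma bracket_sum_right:
  assumes "\<And>i. i \<in> I \<Longrightarrow> g i \<in> Hom G D D'" "f \<in> Hom G A A'"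
  shows "br f (\<Sum>i\<in>I. g i) = (\<Sum>i\<in>I. br f (g i))"
  using assms
proof (induction I rule: infinite_finite_induct)
  case (insert i I)
  then show ?case using add_right[of f A A' "g i" D D' "\<Sum>i\<in>I. g i"] Hom_sum[of I g D D'] by simp
qed (use bracket_zero in auto)

text \<open>Each meeting of \<open>P\<close> and \<open>Q\<close> comes from exactly one meeting of
  exchanged walks, so the coefficient of a fixed pair \<open>P\<close>, \<open>Q\<close> collects
  all meetings of these two walks.\<close>

lemma bracket_walk_sums:
  "br (\<Sum>p\<in>{p. awalk u p v}. basis (u, p)) (\<Sum>q\<in>{q. awalk u' q v'}. basis (u', q)) =
    (\<Sum>P\<in>{P. awalk u' P v}. \<Sum>Q\<in>{Q. awalk u Q v'}.
      smul (\<Sum>f\<leftarrow>Q. \<Sum>e\<leftarrow>P. tw e f + hw f e) (basis ((u', P), (u, Q))))"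
proof -
  define ht :: "'e list \<Rightarrow> 'e list \<Rightarrow> nat \<Rightarrow> nat \<Rightarrow> ('v, 'e, 'k) tens" where
    "ht p q a b = smul (tw (p ! a) (q ! b)) (basis ((u', take b q @ drop a p), (u, take a p @ drop b q)))" for p q a b
  define hh :: "'e list \<Rightarrow> 'e list \<Rightarrow> nat \<Rightarrow> nat \<Rightarrow> ('v, 'e, 'k) tens" where
    "hh p q a b = smul (hw (p ! a) (q ! b))
        (basis ((u', take (Suc b) q @ drop (Suc a) p), (u, take (Suc a) p @ drop (Suc b) q)))" for p q a b
  define kt :: "'e list \<Rightarrow> 'e list \<Rightarrow> nat \<Rightarrow> nat \<Rightarrow> ('v, 'e, 'k) tens" where
    "kt P Q b a = smul (tw (P ! b) (Q ! a)) (basis ((u', P), (u, Q)))" for P Q b a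
  define kh :: "'e list \<Rightarrow> 'e list \<Rightarrow> nat \<Rightarrow> nat \<Rightarrow> ('v, 'e, 'k) tens" where
    "kh P Q b a = smul (hw (Q ! a) (P ! b)) (basis ((u', P), (u, Q)))" for P Q b a
  have t0: "tw e f = (0::'k)" if "end_at 0 e \<noteq> end_at 0 f" for e f
    using that by (intro tail_weight_zero) (simp add: end_at_def)
  have h0: "hw e f = (0::'k)" if "end_at 1 e \<noteq> end_at 1 f" for e f
    using that by (intro head_weight_zero) (simp add: end_at_def)
  \<comment> \<open>Weights vanish off the meetings. This is used in both directions: to restrict
    the sums before the exchange, and to extend them to all pairs of edges after it.\<close>
  have zt: "(\<Sum>p\<in>{p. awalk x p y}. \<Sum>q\<in>{q. awalk x' q y'}. \<Sum>a<length p. \<Sum>b<length q. h p q a b)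
      = (\<Sum>(p, q, a, b)\<in>meetings s x y x' y'. h p q a b)"
    if "\<And>p q a b. end_at s (p ! a) \<noteq> end_at s (q ! b) \<Longrightarrow> h p q a b = 0"
    for s x y x' y' and h :: "'e list \<Rightarrow> 'e list \<Rightarrow> nat \<Rightarrow> nat \<Rightarrow> ('v, 'e, 'k) tens"
    unfolding meetings_def by (rule nested_list_sum[OF finite_walks finite_walks that])
  have "br (\<Sum>p\<in>{p. awalk u p v}. basis (u, p)) (\<Sum>q\<in>{q. awalk u' q v'}. basis (u', q))
      = (\<Sum>p\<in>{p. awalk u p v}. \<Sum>q\<in>{q. awalk u' q v'}. br (basis (u, p)) (basis (u', q)))"
  proof -
    have "br (\<Sum>p\<in>{p. awalk u p v}. basis (u, p)) (\<Sum>q\<in>{q. awalk u' q v'}. basis (u', q))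
      = (\<Sum>p\<in>{p. awalk u p v}. br (basis (u, p)) (\<Sum>q\<in>{q. awalk u' q v'}. basis (u', q)))"
      by (rule bracket_sum_left[of _ _ u v _ u' v']) (auto intro!: basis_in_Hom Hom_sum)
    also have "\<dots> = (\<Sum>p\<in>{p. awalk u p v}. \<Sum>q\<in>{q. awalk u' q v'}. br (basis (u, p)) (basis (u', q)))"
      by (intro sum.cong refl bracket_sum_right[of _ _ u' v' _ u v]) (auto intro!: basis_in_Hom)
    finally show ?thesis .
  qed
  also have "\<dots> = (\<Sum>p\<in>{p. awalk u p v}. \<Sum>q\<in>{q. awalk u' q v'}.
      \<Sum>a<length p. \<Sum>b<length q. ht p q a b + hh p q a b)"
    unfolding ht_def hh_def by (intro sum.cong refl bracket_walk_walk) auto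
  also have "\<dots> = (\<Sum>(p, q, a, b)\<in>meetings 0 u v u' v'. ht p q a b)
      + (\<Sum>(p, q, a, b)\<in>meetings 1 u v u' v'. hh p q a b)"
    unfolding sum.distrib
    by (intro arg_cong2[of _ _ _ _ "(+)"] zt) (simp_all only: ht_def hh_def t0 h0 smul_simps(1) not_False_eq_True)
  also have "(\<Sum>(p, q, a, b)\<in>meetings 0 u v u' v'. ht p q a b)
      = (\<Sum>(P, Q, b, a)\<in>meetings 0 u' v u v'. kt P Q b a)"
  proof (rule sum_meetings_exchange)
    fix p q :: "'e list" and a b P Q b' a'
    assume a: "a < length p" "b < length q" "exchange 0 (p, q, a, b) = (P, Q, b', a')"
    then show "(case (p, q, a, b) of (p, q, a, b) \<Rightarrow> ht p q a b) = (case (P, Q, b', a') of (P, Q, b, a) \<Rightarrow> kt P Q b a)"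
      using exchange_nth(1)[OF a refl] by (auto simp: ht_def kt_def exchange_def)
  qed simp
  also have "(\<Sum>(p, q, a, b)\<in>meetings 1 u v u' v'. hh p q a b)
      = (\<Sum>(P, Q, b, a)\<in>meetings 1 u' v u v'. kh P Q b a)"
  proof (rule sum_meetings_exchange)
    fix p q :: "'e list" and a b P Q b' a'
    assume a: "a < length p" "b < length q" "exchange 1 (p, q, a, b) = (P, Q, b', a')"
    then show "(case (p, q, a, b) of (p, q, a, b) \<Rightarrow> hh p q a b) = (case (P, Q, b', a') of (P, Q, b, a) \<Rightarrow> kh P Q b a)"
      using exchange_nth(2)[OF a refl] by (auto simp: hh_def kh_def exchange_def)
  qed simp
  also have "(\<Sum>(P, Q, b, a)\<in>meetings 0 u' v u v'. kt P Q b a) + (\<Sum>(P, Q, b, a)\<in>meetings 1 u' v u v'. kh P Q b a)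
      = (\<Sum>P\<in>{P. awalk u' P v}. \<Sum>Q\<in>{Q. awalk u Q v'}. \<Sum>b<length P. \<Sum>a<length Q. kt P Q b a + kh P Q b a)"
    unfolding sum.distrib
    by (intro arg_cong2[of _ _ _ _ "(+)"] zt[symmetric])
       (simp_all only: kt_def kh_def t0 h0[OF not_sym] smul_simps(1) not_False_eq_True)
  also have "\<dots> = (\<Sum>P\<in>{P. awalk u' P v}. \<Sum>Q\<in>{Q. awalk u Q v'}.
      smul (\<Sum>f\<leftarrow>Q. \<Sum>e\<leftarrow>P. tw e f + hw f e) (basis ((u', P), (u, Q))))"
  proof (intro sum.cong refl)
    fix P Q
    have "(\<Sum>b<length P. \<Sum>a<length Q. kt P Q b a + kh P Q b a)
      = smul (\<Sum>b<length P. \<Sum>a<length Q. tw (P ! b) (Q ! a) + hw (Q ! a) (P ! b)) (basis ((u', P), (u, Q)))"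
      unfolding kt_def kh_def smul_add_scalar[symmetric] smul_sum_scalar[symmetric] ..
    also have "(\<Sum>b<length P. \<Sum>a<length Q. tw (P ! b) (Q ! a) + hw (Q ! a) (P ! b))
      = (\<Sum>a<length Q. \<Sum>b<length P. tw (P ! b) (Q ! a) + hw (Q ! a) (P ! b) :: 'k)"
      by (rule sum.swap)
    also have "\<dots> = (\<Sum>f\<leftarrow>Q. \<Sum>e\<leftarrow>P. tw e f + hw f e)"
      by (intro trans[OF _ sum_over_lists] sum.cong refl sum_over_lists)
    finally show "(\<Sum>b<length P. \<Sum>a<length Q. kt P Q b a + kh P Q b a)
      = smul (\<Sum>f\<leftarrow>Q. \<Sum>e\<leftarrow>P. tw e f + hw f e) (basis ((u', P), (u, Q)))" .
  qed
  finally show ?thesis .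
qed

lemma boundary_measurement_walks:
  "boundary_measurement G src snk i j = (\<Sum>p\<in>{p. awalk (src i) p (snk j)}. basis (src i, p))"
proof -
  have "paths G (src i) (snk j) = Pair (src i) ` {p. awalk (src i) p (snk j)}"
    by (auto simp: paths_def)
  then show ?thesis
    by (simp add: boundary_measurement_def sum.reindex inj_on_def)
qed

text \<open>The coefficient of a pair of walks depends only on the labels of their ends, so it
  factors out, and what remains is a full tensor of two boundary measurements.\<close>

lemma bracket_boundary_measurement:
  assumes lab: "separated_labelling G pos m n src snk"
    and ijkl: "i \<in> {1..m}" "k \<in> {1..m}" "j \<in> {1..n}" "l \<in> {1..n}"
  defines "B \<equiv> boundary_measurement G src snk"
  shows "br (B i j) (B k l) =
    smul ((of_bool (k < i) - of_bool (i < k) - (of_bool (j < l) - of_bool (l < j))) / 2)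
      (tensor (B k j) (B i l))"
proof -
  have "tensor (B k j) (B i l) =
      (\<Sum>P\<in>{P. awalk (src k) P (snk j)}. \<Sum>Q\<in>{Q. awalk (src i) Q (snk l)}. basis ((src k, P), (src i, Q)))"
    unfolding B_def boundary_measurement_walks tensor_def bilinear_ext_simps bilinear_ext_basis by (rule sum.swap)
  moreover have "br (B i j) (B k l) =
      (\<Sum>P\<in>{P. awalk (src k) P (snk j)}. \<Sum>Q\<in>{Q. awalk (src i) Q (snk l)}.
        smul ((of_bool (k < i) - of_bool (i < k) - (of_bool (j < l) - of_bool (l < j))) / 2)
          (basis ((src k, P), (src i, Q))))"
    unfolding B_def boundary_measurement_walks bracket_walk_sums
    by (intro sum.cong refl arg_cong2[of _ _ _ _ smul] crossing_weight[OF lab _ _ ijkl]) auto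
  ultimately show ?thesis by (simp only: smul_sum)
qed

end

section \<open>Products with the r-matrices and the final comparison\<close>

lemma r_matrix_eval:
  assumes "i \<in> {1..n}" "k \<in> {1..n}"
  shows "(r_matrix n i j k l :: 'k::field_char_0) =
    (if j = k \<and> l = i then (of_bool (k < i) - of_bool (i < k)) / 2 else 0)"
proof -
  let ?S = "{(a, b). 1 \<le> a \<and> a < b \<and> b \<le> n}"
  have fin: "finite ?S" by (rule finite_subset[of _ "{1..n} \<times> {1..n}"]) auto
  have "(\<Sum>(a, b)\<in>?S. unit_bimatrix b a a b i j k l :: 'k) =
      (\<Sum>x\<in>?S. if x = (k, i) then of_bool (j = k \<and> l = i) else 0)"
    by (intro sum.cong) (auto simp: unit_bimatrix_def)
  also have "\<dots> = (if k < i then of_bool (j = k \<and> l = i) else 0)"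
    using assms by (subst sum.delta[OF fin]) auto
  finally have 1: "(\<Sum>(a, b)\<in>?S. unit_bimatrix b a a b i j k l :: 'k) = of_bool (k < i \<and> j = k \<and> l = i)"
    by simp
  have "(\<Sum>(a, b)\<in>?S. unit_bimatrix a b b a i j k l :: 'k) =
      (\<Sum>x\<in>?S. if x = (i, k) then of_bool (j = k \<and> l = i) else 0)"
    by (intro sum.cong) (auto simp: unit_bimatrix_def)
  also have "\<dots> = (if i < k then of_bool (j = k \<and> l = i) else 0)"
    using assms by (subst sum.delta[OF fin]) auto
  finally have 2: "(\<Sum>(a, b)\<in>?S. unit_bimatrix a b b a i j k l :: 'k) = of_bool (i < k \<and> j = k \<and> l = i)"
    by simp
  show ?thesis
    unfolding r_matrix_def using 1 2 by (simp add: split_def sum_subtractf)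
qed

lemma sum_sum_delta:
  assumes "finite A" "finite B" "x \<in> A" "y \<in> B"
  shows "(\<Sum>p\<in>A. \<Sum>q\<in>B. smul (if p = x \<and> q = y then c else 0) (f p q)) = smul c (f x y)"
proof -
  have "(\<Sum>q\<in>B. smul (if p = x \<and> q = y then c else 0) (f p q)) = (if p = x then smul c (f x y) else 0)" for p
  proof -
    have "(\<Sum>q\<in>B. smul (if p = x \<and> q = y then c else 0) (f p q)) =
        (\<Sum>q\<in>B. if q = y then (if p = x then smul c (f x y) else 0) else 0)"
      by (intro sum.cong) auto
    then show ?thesis using assms by simp
  qed
  then show ?thesis using assms by simp
qed

text \<open>\<open>r_matrix\<close> is half of a signed flip, so only \<open>p = k\<close>,
  \<open>q = i\<close> survives and the row indices trade places; multiplication from the right does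
  the same to the column indices.\<close>

lemma lmult_r_matrix:
  assumes "i \<in> {1..m}" "k \<in> {1..m}"
  shows "lmult m (r_matrix m) X i j k l = smul ((of_bool (k < i) - of_bool (i < k)) / 2) (X k j i l)"
  unfolding lmult_def r_matrix_eval[OF assms] using assms by (intro sum_sum_delta) auto

lemma rmult_r_matrix:
  assumes "j \<in> {1..n}" "l \<in> {1..n}"
  shows "rmult n X (r_matrix n) i j k l = smul ((of_bool (j < l) - of_bool (l < j)) / 2) (X i l k j)"
proof -
  have "rmult n X (r_matrix n) i j k l = (\<Sum>p\<in>{1..n}. \<Sum>q\<in>{1..n}.
      smul (if p = l \<and> q = j then (of_bool (j < l) - of_bool (l < j)) / 2 else 0) (X i p k q))"
    unfolding rmult_def by (intro sum.cong refl arg_cong2[of _ _ _ _ smul]) (auto simp: r_matrix_eval)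
  then show ?thesis using assms by (simp add: sum_sum_delta)
qed

theorem theorem24:
  fixes G :: "('v, 'e) pre_digraph"
    and pos :: "'v \<Rightarrow> complex" and crv :: "'e \<Rightarrow> real \<Rightarrow> complex"
    and m n :: nat and src snk :: "nat \<Rightarrow> 'v"
    and br :: "('v, 'e, 'k::field_char_0) mor \<Rightarrow> ('v, 'e, 'k) mor \<Rightarrow> ('v, 'e, 'k) tens"
  assumes "perfect_planar_network G pos crv"
    and "acyclic_network G"
    and "separated_labelling G pos m n src snk"
    and "standard_double_bracket G pos crv br"
  shows "let B = boundary_measurement G src snk in
           bimatrix_eq m n (matrix_bracket br B B)
             (bimatrix_diff (lmult m (r_matrix m) (LR_product B B))
                (tau_bimatrix (rmult n (LR_product B B) (r_matrix n)))) \<and>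
           (m = n \<longrightarrow>
             bimatrix_eq n n (matrix_bracket br B B)
               (twisted_commutator n (r_matrix n) (LR_product B B)))"
proof -
  interpret network_bracket G pos crv br
    using assms by (simp add: network_bracket_def acyclic_planar_network_def acyclic_planar_network_axioms_def)
  define B :: "('v, 'e, 'k) mor matrix_fn" where "B = boundary_measurement G src snk"
  have tau: "tau (tensor (B i l) (B k j)) = tensor (B k j) (B i l)" for i j k l
    unfolding B_def boundary_measurement_walks by (rule tau_tensor_sums)
  have "bimatrix_eq m n (matrix_bracket br B B)
             (bimatrix_diff (lmult m (r_matrix m) (LR_product B B))
                (tau_bimatrix (rmult n (LR_product B B) (r_matrix n))))"
    unfolding bimatrix_eq_def
  proof (intro ballI)
    fix i j k l assume ijkl: "i \<in> {1..m}" "j \<in> {1..n}" "k \<in> {1..m}" "l \<in> {1..n}"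
    have ring: "(x - y) / 2 * z = x / 2 * z - y / 2 * z" for x y z :: 'k
      by (simp add: field_simps)
    \<comment> \<open>Everything is a multiple of \<open>tensor (B k j) (B i l)\<close>. The flip of
      rows yields it directly; the flip of columns yields \<open>tensor (B i l) (B k j)\<close>,
      which \<tau> brings into the same order.\<close>
    show "matrix_bracket br B B i j k l = bimatrix_diff (lmult m (r_matrix m) (LR_product B B))
                (tau_bimatrix (rmult n (LR_product B B) (r_matrix n))) i j k l"
      unfolding matrix_bracket_def bimatrix_diff_def tau_bimatrix_def LR_product_def
        lmult_r_matrix[OF ijkl(1,3)] rmult_r_matrix[OF ijkl(2,4)] tau_smul tau
        bracket_boundary_measurement[OF assms(3) ijkl(1,3,2,4), folded B_def]
      by (rule poly_mapping_eqI) (simp only: lookup_minus lookup_smul ring)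
  qed
  then show ?thesis by (auto simp: Let_def B_def twisted_commutator_def)
qed

end
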